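(* Let $\lambda=\log\frac{3+\sqrt5}{2}$ and let $M,N\in\mathbb R$ be arbitrary constants. Consider the ODE system $$\begin{cases}\partial_t\alpha=4\lambda^2\alpha\,(4\beta\gamma-(M-N)^2),\\ \partial_t\beta=4\lambda^2\beta\,(4\alpha\delta-(M+N)^2),\\ \partial_t\gamma=4\lambda^2\gamma\,(4\alpha\delta-(M+N)^2),\\ \partial_t\delta=4\lambda^2\delta\,(4\beta\gamma-(M-N)^2),\end{cases}$$ with initial data $(\alpha_0,\beta_0,\gamma_0,\delta_0)$ at $t=0$ that is positive, i.e. satisfies (1) $\alpha,\beta,\gamma,\delta$ are all positive or all negative; (2) $\alpha\delta+\beta\gamma>M^2$ and $\alpha\delta+\beta\gamma>N^2$; (3) $-4\alpha\beta\gamma\delta+\alpha\delta(M-N)^2+\beta\gamma(M+N)^2<0$. Then the solution has a finite-time singularity. Let $T<\infty$ be its maximal existence time and let $$\begin{aligned}\varphi(t)=&\,\alpha(t)(e^{135}+e^{136})+\beta(t)(e^{145}-e^{146})+\gamma(t)(e^{235}-e^{236})-\delta(t)(e^{245}+e^{246})\\&+(Me^5+Ne^6)\wedge(e^{12}-e^{34})\end{aligned}$$ be the corresponding 3-form on the symplectic Lie algebra $(\mathfrak g,\omega)$, where $\mathfrak g=(-e^{15},e^{25},-e^{36},e^{46},0,0)$ and $\omega=\frac1{\lambda^2}(e^{12}+e^{34}+e^{56})$. Then the limit $$\lim_{t\to T}\alpha(t)^{-1}\varphi(t)=\varphi_\infty$$ exists smoothly. Moreover, $\varphi_\infty$ defines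 a harmonic almost complex structure.
   Context: Notation: $e^{ij}=e^i\wedge e^j$, $e^{ijk}=e^i\wedge e^j\wedge e^k$. The symbol $(-e^{15},e^{25},-e^{36},e^{46},0,0)$ denotes the Lie algebra $\mathfrak g$ with basis $e_1,\dots,e_6$ and dual basis $e^1,\dots,e^6$ satisfying $\mathrm de^1=-e^{15}$, $\mathrm de^2=e^{25}$, $\mathrm de^3=-e^{36}$, $\mathrm de^4=e^{46}$, $\mathrm de^5=\mathrm de^6=0$, where $\mathrm d$ is the Chevalley–Eilenberg differential ($\mathrm de^k=-\frac12c_{ij}^ke^i\wedge e^j$, $[e_i,e_j]=c_{ij}^ke_k$). Elements of $\bigwedge^*\mathfrak g^*$ are identified with left-invariant forms on the corresponding Lie group (and on its quotients by cocompact discrete subgroups), so that convergence of left-invariant forms is convergence of their coefficients. The ODE system above is the reduction of the Type IIA flow $\partial_t\varphi=\mathrm d\Lambda_\omega\mathrm d\,\mathcal F(\varphi)$ for closed primitive left-invariant 3-forms; conditions (1)–(3) express that the closed primitive form $\varphi$ is positive, and they are preserved along the flow. Almost complex structure of a 3-form: for a 3-form $\varphi$ on a 6-dimensional symplectic vector space $(V,\omega)$, define $\mathcal K(\varphi)\in\mathrm{End}(V)$ by $\mathcal K(\varphi)(v)\cdot\frac{\omega^3}{3!}=-\sum_ie_i\otimes(e^i\wedge\iota_v\varphi\wedge\varphi)$, the 3-form $\mathcal F(\varphi)$ by $\mathcal F(\varphi)(v_1,v_2,v_3)=-2\varphi(\mathcal K(\varphi)v_1,v_2,v_3)$, and $\mathcal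 Q(\varphi)\in\mathbb R$ by $\mathcal Q(\varphi)\frac{\omega^3}{3!}=-\varphi\wedge\mathcal F(\varphi)$. If $\mathcal Q(\varphi)<0$, then $\mathcal J(\varphi)=\frac{2\mathcal K(\varphi)}{\sqrt{-\mathcal Q(\varphi)}}$ satisfies $\mathcal J(\varphi)^2=-\mathrm{id}$. For primitive $\varphi$ (i.e. $\omega\wedge\varphi=0$) with $\mathcal Q(\varphi)<0$, $g(\cdot,\cdot)=\omega(\cdot,\mathcal J(\varphi)\cdot)$ is a nondegenerate symmetric bilinear form, and $\varphi$ is called positive if $g$ is positive definite. The almost complex structure defined by $\varphi_\infty$ is $J=\mathcal J(\varphi_\infty)$, regarded as a left-invariant $\omega$-compatible almost complex structure. Harmonic almost complex structure: an $\omega$-compatible almost complex structure $J$ with associated metric $g=\omega(\cdot,J\cdot)$ is harmonic if the Ricci tensor of $g$ is $J$-invariant, $\mathrm{Ric}(JX,JY)=\mathrm{Ric}(X,Y)$ for all $X,Y$ (this is the Euler–Lagrange equation of the energy $\int|\nabla J|^2$ among $\omega$-compatible almost complex structures). *)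

theory Defs
  imports "HOL-Analysis.Analysis"
begin

section \<open>Exterior forms\<close>

text \<open>
  A vector of the Lie algebra is given by its coordinates in the basis \<open>e\<^sub>1, \<dots>, e\<^sub>6\<close>, so it is an
  element of \<open>real ^ 6\<close>.  The numeral 6 equals 0 in the index type \<open>6\<close>: \<open>v $ 6\<close> is the coordinate
  along \<open>e\<^sub>6\<close> and the six indices are 1, 2, 3, 4, 5, 6 as expected.  The order of the type \<open>6\<close>, which
  would put 6 first, is never used.

  A \<open>p\<close>-form is an alternating multilinear function of \<open>p\<close> vectors, extended by 0 to the lists of
  vectors whose length is not \<open>p\<close>.
\<close>

type_synonym vector = "real ^ 6"
type_synonym form = "vector list \<Rightarrow> real"

definition coframe :: "6 \<Rightarrow> form" where
  "coframe i vs = (case vs of [v] \<Rightarrow> v $ i | _ \<Rightarrow> 0)"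

definition interior :: "vector \<Rightarrow> form \<Rightarrow> form" where
  "interior v \<phi> vs = \<phi> (v # vs)"

text \<open>
  The wedge product is the usual sum over shuffles (so \<open>e\<^sup>i \<and> e\<^sup>j\<close> takes the value 1 on \<open>(e\<^sub>i, e\<^sub>j)\<close>).
  A shuffle is determined by the set \<open>I\<close> of positions whose vectors are passed to the left factor,
  and the exponent counts its inversions.
\<close>

definition shuffle_sign :: "nat set \<Rightarrow> real" where
  "shuffle_sign I = (- 1) ^ card {(i, j). i \<in> I \<and> j \<notin> I \<and> j < i}"

definition wedge :: "form \<Rightarrow> form \<Rightarrow> form"  (infixr "\<and>\<^sub>f" 70) where
  "(a \<and>\<^sub>f b) vs = (\<Sum>I\<in>Pow {..<length vs}. shuffle_sign I * a (nths vs I) * b (nths vs (- I)))"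

abbreviation e2 :: "6 \<Rightarrow> 6 \<Rightarrow> form" where
  "e2 i j \<equiv> coframe i \<and>\<^sub>f coframe j"

abbreviation e3 :: "6 \<Rightarrow> 6 \<Rightarrow> 6 \<Rightarrow> form" where
  "e3 i j k \<equiv> coframe i \<and>\<^sub>f coframe j \<and>\<^sub>f coframe k"

lemma e2_apply: "e2 i j [u, v] = u $ i * v $ j - u $ j * v $ i"
proof -
  have P: "Pow {..<Suc (Suc 0)} = {{}, {0}, {1}, {0, 1}}"
    by (auto simp: lessThan_Suc Pow_insert)
  have s1: "{(i, j). i = 0 \<and> 0 < j \<and> j < (i::nat)} = {}" by auto
  have s2: "{(i, j). i = Suc 0 \<and> j \<noteq> Suc 0 \<and> j < i} = {(Suc 0, 0)}" by auto
  show ?thesis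
    by (simp add: wedge_def P coframe_def nths_Cons shuffle_sign_def s1 s2)
qed


section \<open>The almost complex structure of a 3-form\<close>

definition volume :: "form \<Rightarrow> form" where
  "volume \<omega> vs = (\<omega> \<and>\<^sub>f \<omega> \<and>\<^sub>f \<omega>) vs / fact 3"

text \<open>
  The space of 6-forms is one-dimensional, so the number \<open>r\<close> with \<open>\<eta> = r \<omega>\<^sup>3/3!\<close> is the quotient
  of the values on the basis.
\<close>

definition top_ratio :: "form \<Rightarrow> form \<Rightarrow> real" where
  "top_ratio \<omega> \<eta> =
     (let E = [axis 1 1, axis 2 1, axis 3 1, axis 4 1, axis 5 1, axis 6 1] in \<eta> E / volume \<omega> E)"

definition calK :: "form \<Rightarrow> form \<Rightarrow> vector \<Rightarrow> vector" where
  "calK \<omega> \<phi> v = (\<chi> i. - top_ratio \<omega> (coframe i \<and>\<^sub>f interior v \<phi> \<and>\<^sub>f \<phi>))"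

definition calF :: "form \<Rightarrow> form \<Rightarrow> form" where
  "calF \<omega> \<phi> vs = (case vs of [v1, v2, v3] \<Rightarrow> - 2 * \<phi> [calK \<omega> \<phi> v1, v2, v3] | _ \<Rightarrow> 0)"

definition calQ :: "form \<Rightarrow> form \<Rightarrow> real" where
  "calQ \<omega> \<phi> = - top_ratio \<omega> (\<phi> \<and>\<^sub>f calF \<omega> \<phi>)"

definition calJ :: "form \<Rightarrow> form \<Rightarrow> vector \<Rightarrow> vector" where
  "calJ \<omega> \<phi> v = (2 / sqrt (- calQ \<omega> \<phi>)) *\<^sub>R calK \<omega> \<phi> v"


section \<open>Harmonic almost complex structures\<close>

text \<open>
  Left-invariant metrics are inner products on the Lie algebra, and \<open>br\<close> is the Lie bracket.  On
  left-invariant vector fields the functions \<open>g(Y, Z)\<close> are constant, so the condition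
  \<open>\<nabla>g = 0\<close> has no derivative term.
\<close>

definition levi_civita ::
  "(vector \<Rightarrow> vector \<Rightarrow> vector) \<Rightarrow> (vector \<Rightarrow> vector \<Rightarrow> real) \<Rightarrow> (vector \<Rightarrow> vector \<Rightarrow> vector) \<Rightarrow> bool"
where
  "levi_civita br g D \<longleftrightarrow>
     bilinear D \<and>
     (\<forall>X Y. D X Y - D Y X = br X Y) \<and>
     (\<forall>X Y Z. g (D X Y) Z + g Y (D X Z) = 0)"

definition curvature ::
  "(vector \<Rightarrow> vector \<Rightarrow> vector) \<Rightarrow> (vector \<Rightarrow> vector \<Rightarrow> vector) \<Rightarrow> vector \<Rightarrow> vector \<Rightarrow> vector \<Rightarrow> vector"
where
  "curvature br D X Y Z = D X (D Y Z) - D Y (D X Z) - D (br X Y) Z"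

definition ricci ::
  "(vector \<Rightarrow> vector \<Rightarrow> vector) \<Rightarrow> (vector \<Rightarrow> vector \<Rightarrow> real) \<Rightarrow> vector \<Rightarrow> vector \<Rightarrow> real"
where
  "ricci br g Y Z = trace (matrix (\<lambda>X. curvature br (THE D. levi_civita br g D) X Y Z))"

definition compatible_acs :: "form \<Rightarrow> (vector \<Rightarrow> vector) \<Rightarrow> bool" where
  "compatible_acs \<omega> J \<longleftrightarrow>
     linear J \<and> (\<forall>v. J (J v) = - v) \<and>
     (\<forall>u v. \<omega> [J u, J v] = \<omega> [u, v]) \<and> (\<forall>v. v \<noteq> 0 \<longrightarrow> \<omega> [v, J v] > 0)"

definition harmonic_acs ::
  "(vector \<Rightarrow> vector \<Rightarrow> vector) \<Rightarrow> form \<Rightarrow> (vector \<Rightarrow> vector) \<Rightarrow> bool"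
where
  "harmonic_acs br \<omega> J \<longleftrightarrow>
     compatible_acs \<omega> J \<and>
     (let Ric = ricci br (\<lambda>u v. \<omega> [u, J v]) in \<forall>X Y. Ric (J X) (J Y) = Ric X Y)"

text \<open>The definite description in the Ricci tensor is well-defined.\<close>

lemma levi_civita_ex1:
  assumes br: "bilinear br" "\<And>X Y. br Y X = - br X Y"
    and g: "bilinear g" "\<And>X Y. g X Y = g Y X" "\<And>X. X \<noteq> 0 \<Longrightarrow> g X X > 0"
  shows "\<exists>!D. levi_civita br g D"
proof -
  define L :: "vector \<Rightarrow> vector" where "L w = (\<chi> i. g w (axis i 1))" for w
  have linL: "linear L"
    by (rule linearI) (simp_all add: L_def vec_eq_iff bilinear_ladd[OF g(1)] bilinear_lmul[OF g(1)])
  have Leq: "g w z = L w \<bullet> z" for w z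
  proof -
    have "z = (\<Sum>i\<in>UNIV. z $ i *\<^sub>R axis i 1)"
      using basis_expansion[of z] by (simp add: scalar_mult_eq_scaleR)
    then have "g w z = (\<Sum>i\<in>UNIV. g w (z $ i *\<^sub>R axis i 1))"
      using g(1) by (metis bilinear_def linear_sum)
    also have "\<dots> = (\<Sum>i\<in>UNIV. z $ i * g w (axis i 1))"
      by (simp add: bilinear_rmul[OF g(1)])
    finally show ?thesis by (simp add: L_def inner_vec_def mult.commute)
  qed
  have gl: "g (a + b) c = g a c + g b c" "g (a - b) c = g a c - g b c"
    "g c (a + b) = g c a + g c b" "g c (a - b) = g c a - g c b"
    "g (- a) c = - g a c" "g c (- a) = - g c a"
    "g (r *\<^sub>R a) c = r * g a c" "g c (r *\<^sub>R a) = r * g c a" for a b c r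
    by (simp_all add: bilinear_ladd[OF g(1)] bilinear_radd[OF g(1)] bilinear_lsub[OF g(1)]
        bilinear_rsub[OF g(1)] bilinear_lneg[OF g(1)] bilinear_rneg[OF g(1)]
        bilinear_lmul[OF g(1)] bilinear_rmul[OF g(1)])
  have nondeg: "a = b" if "\<And>z. g a z = g b z" for a b
    using that[of "a - b"] g(3)[of "a - b"] gl by fastforce
  have injL: "inj L"
    by (rule injI) (metis Leq nondeg)
  then have surjL: "surj L"
    using linL linear_injective_imp_surjective by blast
  define kos where "kos X Y Z = (g (br X Y) Z - g (br Y Z) X + g (br Z X) Y) / 2" for X Y Z
  define D where "D X Y = inv L (\<chi> i. kos X Y (axis i 1))" for X Y
  have brl: "br (a + b) c = br a c + br b c" "br c (a + b) = br c a + br c b"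
    "br (r *\<^sub>R a) c = r *\<^sub>R br a c" "br c (r *\<^sub>R a) = r *\<^sub>R br c a" for a b c r
    by (simp_all add: bilinear_ladd[OF br(1)] bilinear_radd[OF br(1)]
        bilinear_lmul[OF br(1)] bilinear_rmul[OF br(1)])
  have gD: "g (D X Y) Z = kos X Y Z" for X Y Z
  proof -
    have lk: "linear (kos X Y)"
      by (rule linearI) (simp_all add: kos_def gl brl algebra_simps add_divide_distrib diff_divide_distrib)
    have "g (D X Y) Z = (\<chi> i. kos X Y (axis i 1)) \<bullet> Z"
      by (simp add: Leq D_def surj_f_inv_f[OF surjL])
    also have "\<dots> = (\<Sum>i\<in>UNIV. kos X Y (Z $ i *\<^sub>R axis i 1))"
      by (simp add: inner_vec_def linear_cmul[OF lk] mult.commute)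
    also have "\<dots> = kos X Y Z"
      using basis_expansion[of Z] by (simp add: scalar_mult_eq_scaleR flip: linear_sum[OF lk])
    finally show ?thesis .
  qed
  have "levi_civita br g D"
    unfolding levi_civita_def bilinear_def
  proof (intro conjI allI)
    show "linear (D X)" for X
      by (rule linearI; rule nondeg)
        (simp_all add: gD gl kos_def brl algebra_simps add_divide_distrib diff_divide_distrib)
    show "linear (\<lambda>X. D X Y)" for Y
      by (rule linearI; rule nondeg)
        (simp_all add: gD gl kos_def brl algebra_simps add_divide_distrib diff_divide_distrib)
    show "D X Y - D Y X = br X Y" for X Y
    proof (rule nondeg)
      fix Z
      show "g (D X Y - D Y X) Z = g (br X Y) Z"
        using br(2)[of X Y] br(2)[of X Z] br(2)[of Y Z] by (simp add: gD gl kos_def field_simps)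
    qed
    show "g (D X Y) Z + g Y (D X Z) = 0" for X Y Z
      using br(2)[of X Y] br(2)[of X Z] br(2)[of Y Z] g(2)[of Y "D X Z"]
      by (simp add: gD gl kos_def field_simps)
  qed
  moreover have "D1 = D2" if "levi_civita br g D1" "levi_civita br g D2" for D1 D2
  proof -
    have koszul: "g (D' X Y) Z = kos X Y Z" if "levi_civita br g D'" for D' X Y Z
    proof -
      have t: "br X Y = D' X Y - D' Y X" and m: "g (D' X Y) Z = - g Y (D' X Z)" for X Y Z
        using that by (auto simp: levi_civita_def eq_neg_iff_add_eq_0)
      show ?thesis
        using m[of X Y Z] m[of Y Z X] m[of Z X Y] g(2)
        by (simp add: kos_def t gl)
    qed
    show ?thesis
      by (intro ext nondeg) (simp add: koszul that)
  qed
  ultimately show ?thesis by blast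
qed


section \<open>The symplectic Lie algebra\<close>

definition dcoframe :: "6 \<Rightarrow> form" where
  "dcoframe k vs =
     (if k = 1 then - e2 1 5 vs
      else if k = 2 then e2 2 5 vs
      else if k = 3 then - e2 3 6 vs
      else if k = 4 then e2 4 6 vs
      else 0)"

text \<open>The convention for the Chevalley--Eilenberg differential is \<open>de\<^sup>k(X, Y) = - e\<^sup>k([X, Y])\<close>.\<close>

definition bracket :: "vector \<Rightarrow> vector \<Rightarrow> vector" where
  "bracket X Y = (\<chi> k. - dcoframe k [X, Y])"

definition lam :: real where
  "lam = ln ((3 + sqrt 5) / 2)"

definition omega :: form where
  "omega vs = (1 / lam\<^sup>2) * (e2 1 2 vs + e2 3 4 vs + e2 5 6 vs)"

definition phi :: "real \<Rightarrow> real \<Rightarrow> real \<Rightarrow> real \<Rightarrow> real \<Rightarrow> real \<Rightarrow> form" where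
  "phi M N \<alpha> \<beta> \<gamma> \<delta> vs =
     \<alpha> * (e3 1 3 5 vs + e3 1 3 6 vs) + \<beta> * (e3 1 4 5 vs - e3 1 4 6 vs)
     + \<gamma> * (e3 2 3 5 vs - e3 2 3 6 vs) - \<delta> * (e3 2 4 5 vs + e3 2 4 6 vs)
     + ((\<lambda>us. M * coframe 5 us + N * coframe 6 us) \<and>\<^sub>f (\<lambda>us. e2 1 2 us - e2 3 4 us)) vs"


section \<open>The ODE system\<close>

definition flow_solution ::
  "real \<Rightarrow> real \<Rightarrow> ereal \<Rightarrow> (real \<Rightarrow> real) \<Rightarrow> (real \<Rightarrow> real) \<Rightarrow> (real \<Rightarrow> real) \<Rightarrow> (real \<Rightarrow> real) \<Rightarrow> bool"
where
  "flow_solution M N T \<alpha> \<beta> \<gamma> \<delta> \<longleftrightarrow>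
     (let S = {t. 0 \<le> t \<and> ereal t < T} in
      \<forall>t\<in>S.
        (\<alpha> has_real_derivative 4 * lam\<^sup>2 * \<alpha> t * (4 * \<beta> t * \<gamma> t - (M - N)\<^sup>2)) (at t within S) \<and>
        (\<beta> has_real_derivative 4 * lam\<^sup>2 * \<beta> t * (4 * \<alpha> t * \<delta> t - (M + N)\<^sup>2)) (at t within S) \<and>
        (\<gamma> has_real_derivative 4 * lam\<^sup>2 * \<gamma> t * (4 * \<alpha> t * \<delta> t - (M + N)\<^sup>2)) (at t within S) \<and>
        (\<delta> has_real_derivative 4 * lam\<^sup>2 * \<delta> t * (4 * \<beta> t * \<gamma> t - (M - N)\<^sup>2)) (at t within S))"

text \<open>
  \<open>T\<close> is the maximal existence time of the solution: it cannot be extended to any \<open>[0, T')\<close> with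
  \<open>T' > T\<close>.
\<close>

definition maximal_flow_solution ::
  "real \<Rightarrow> real \<Rightarrow> ereal \<Rightarrow> (real \<Rightarrow> real) \<Rightarrow> (real \<Rightarrow> real) \<Rightarrow> (real \<Rightarrow> real) \<Rightarrow> (real \<Rightarrow> real) \<Rightarrow> bool"
where
  "maximal_flow_solution M N T \<alpha> \<beta> \<gamma> \<delta> \<longleftrightarrow>
     0 < T \<and> flow_solution M N T \<alpha> \<beta> \<gamma> \<delta> \<and>
     \<not> (\<exists>T' \<alpha>' \<beta>' \<gamma>' \<delta>'. T < T' \<and> flow_solution M N T' \<alpha>' \<beta>' \<gamma>' \<delta>' \<and>
          (\<forall>t. 0 \<le> t \<and> ereal t < T \<longrightarrow>
             \<alpha>' t = \<alpha> t \<and> \<beta>' t = \<beta> t \<and> \<gamma>' t = \<gamma> t \<and> \<delta>' t = \<delta> t))"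

definition positive_data :: "real \<Rightarrow> real \<Rightarrow> real \<Rightarrow> real \<Rightarrow> real \<Rightarrow> real \<Rightarrow> bool" where
  "positive_data M N \<alpha> \<beta> \<gamma> \<delta> \<longleftrightarrow>
     (\<alpha> > 0 \<and> \<beta> > 0 \<and> \<gamma> > 0 \<and> \<delta> > 0 \<or> \<alpha> < 0 \<and> \<beta> < 0 \<and> \<gamma> < 0 \<and> \<delta> < 0) \<and>
     (\<alpha> * \<delta> + \<beta> * \<gamma> > M\<^sup>2 \<and> \<alpha> * \<delta> + \<beta> * \<gamma> > N\<^sup>2) \<and>
     - 4 * \<alpha> * \<beta> * \<gamma> * \<delta> + \<alpha> * \<delta> * (M - N)\<^sup>2 + \<beta> * \<gamma> * (M + N)\<^sup>2 < 0"

end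

theory Submission
  imports Defs
begin

text \<open>
  The ratios \<open>\<delta>/\<alpha>\<close> and \<open>\<gamma>/\<beta>\<close> are constant, so \<open>\<alpha> = \<alpha>\<^sub>0 e\<^sup>x\<close>, \<open>\<delta> = \<delta>\<^sub>0 e\<^sup>x\<close>, \<open>\<beta> = \<beta>\<^sub>0 e\<^sup>y\<close>,
  \<open>\<gamma> = \<gamma>\<^sub>0 e\<^sup>y\<close> with \<open>x' = k (b e\<^bsup>2y\<^esup> - B)\<close>, \<open>y' = k (a e\<^bsup>2x\<^esup> - A)\<close>, where \<open>a = 4\<alpha>\<^sub>0\<delta>\<^sub>0 > A = (M + N)\<^sup>2\<close> and
  \<open>b = 4\<beta>\<^sub>0\<gamma>\<^sub>0 > B = (M - N)\<^sup>2\<close> by positivity.  The quantity \<open>a e\<^bsup>2x\<^esup> - 2Ax - (b e\<^bsup>2y\<^esup> - 2By)\<close> is conserved.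
  Hence \<open>x' \<ge> c (1 + x\<^sup>2)\<close>, which forces blow-up in finite time, and \<open>e\<^bsup>2(y - x)\<^esup> \<rightarrow> a/b\<close> as \<open>x \<rightarrow> \<infinity>\<close>.

  If \<open>\<beta>/\<alpha> \<rightarrow> p\<close> and \<open>\<gamma>/\<alpha> \<rightarrow> q\<close>, then \<open>\<delta>/\<alpha> = p q\<close>, and the limiting form is the real part of
  \<open>(1 - i) (e\<^sup>1 + i q e\<^sup>2) \<and> (e\<^sup>3 + i p e\<^sup>4) \<and> (e\<^sup>5 + i e\<^sup>6)\<close>.  Its metric is diagonal and makes the Lie
  algebra a product of two copies of Sol, whose Ricci tensor \<open>-2 (e\<^sup>5 \<otimes> e\<^sup>5 + e\<^sup>6 \<otimes> e\<^sup>6)\<close> is invariant under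
  the rotation that \<open>J\<close> induces on the plane of \<open>e\<^sub>5, e\<^sub>6\<close>.
\<close>

section \<open>Wedge products\<close>

lemma exhaust_6: fixes x :: 6
  shows "x = 1 \<or> x = 2 \<or> x = 3 \<or> x = 4 \<or> x = 5 \<or> x = 6"
proof (induct x)
  case (of_int z)
  then have "0 \<le> z" "z < 6" by simp_all
  then have "z = 0 \<or> z = 1 \<or> z = 2 \<or> z = 3 \<or> z = 4 \<or> z = 5" by arith
  then show ?case by auto
qed

lemma forall_6: "(\<forall>i::6. P i) \<longleftrightarrow> P 1 \<and> P 2 \<and> P 3 \<and> P 4 \<and> P 5 \<and> P 6"
  by (metis exhaust_6)

lemma UNIV_6: "UNIV = {1::6, 2, 3, 4, 5, 6}"
  using exhaust_6 by auto

lemma sum_6: "sum f (UNIV::6 set) = f 1 + f 2 + f 3 + f 4 + f 5 + f 6"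
  unfolding UNIV_6 by (simp add: ac_simps)

lemma wedge_Nil: "(a \<and>\<^sub>f b) [] = a [] * b []"
  by (simp add: wedge_def shuffle_sign_def)

text \<open>A new first position in the left factor has nothing below it, so it enters no inversion;
  all other positions only shift by one.\<close>

lemma shuffle_sign_insert: "shuffle_sign (insert 0 (Suc ` I)) = shuffle_sign I"
proof -
  have "{(i, j). i \<in> insert 0 (Suc ` I) \<and> j \<notin> insert 0 (Suc ` I) \<and> j < i}
      = map_prod Suc Suc ` {(i, j). i \<in> I \<and> j \<notin> I \<and> j < i}"
  proof (intro set_eqI iffI)
    fix p assume "p \<in> {(i, j). i \<in> insert 0 (Suc ` I) \<and> j \<notin> insert 0 (Suc ` I) \<and> j < i}"
    then obtain i j where p: "p = (i, j)" "i \<in> insert 0 (Suc ` I)" "j \<notin> insert 0 (Suc ` I)" "j < i"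
      by auto
    then obtain i' j' where "i = Suc i'" "j = Suc j'" by (cases i; cases j) auto
    with p show "p \<in> map_prod Suc Suc ` {(i, j). i \<in> I \<and> j \<notin> I \<and> j < i}"
      by (auto intro!: image_eqI[of _ _ "(i', j')"])
  qed auto
  then show ?thesis
    by (simp add: shuffle_sign_def card_image inj_on_def map_prod_def split: prod.splits)
qed

text \<open>A new first position in the right factor lies below every element of \<open>I\<close>
  and creates one further inversion with each of them.\<close>

lemma shuffle_sign_Suc:
  assumes "finite I"
  shows "shuffle_sign (Suc ` I) = (- 1) ^ card I * shuffle_sign I"
proof -
  let ?R = "{(i, j). i \<in> I \<and> j \<notin> I \<and> j < i}"
  have fin: "finite ?R"
  proof (rule finite_subset)
    show "?R \<subseteq> Sigma I (\<lambda>i. {..<i})" by auto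
  qed (simp add: assms)
  have "{(i, j). i \<in> Suc ` I \<and> j \<notin> Suc ` I \<and> j < i}
      = (\<lambda>i. (Suc i, 0)) ` I \<union> map_prod Suc Suc ` ?R" (is "?L = ?U")
  proof (intro set_eqI iffI)
    fix p assume "p \<in> ?L"
    then obtain i j where p: "p = (Suc i, j)" "i \<in> I" "j \<notin> Suc ` I" "j < Suc i"
      by auto
    show "p \<in> ?U"
    proof (cases j)
      case (Suc j')
      with p show ?thesis by (auto intro!: image_eqI[of _ _ "(i, j')"])
    qed (use p in auto)
  qed auto
  moreover have "card ?U = card I + card ?R"
  proof (subst card_Un_disjoint)
    have "card (map_prod Suc Suc ` ?R) = card ?R"
      by (rule card_image) (auto simp: inj_on_def)
    moreover have "card ((\<lambda>i. (Suc i, 0::nat)) ` I) = card I"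
      by (rule card_image) (auto simp: inj_on_def)
    ultimately show "card ((\<lambda>i. (Suc i, 0::nat)) ` I) + card (map_prod Suc Suc ` ?R) = card I + card ?R"
      by simp
  qed (use assms fin in auto)
  ultimately show ?thesis by (simp add: shuffle_sign_def power_add)
qed

text \<open>A shuffle sends \<open>v\<close> either to the left factor or, past all arguments of the left factor, to the
  right one.\<close>

lemma wedge_Cons:
  "(a \<and>\<^sub>f b) (v # vs) =
     ((\<lambda>us. a (v # us)) \<and>\<^sub>f b) vs + ((\<lambda>us. (- 1) ^ length us * a us) \<and>\<^sub>f (\<lambda>us. b (v # us))) vs"
proof -
  let ?n = "length vs"
  let ?t = "\<lambda>I. shuffle_sign I * a (nths (v # vs) I) * b (nths (v # vs) (- I))"
  let ?P = "Pow {..<?n}"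
  have P: "Pow {..<Suc ?n} = (\<lambda>I. insert 0 (Suc ` I)) ` ?P \<union> image Suc ` ?P"
    unfolding lessThan_Suc_eq_insert_0 Pow_insert image_Pow_surj[OF refl, symmetric]
    by (simp add: image_image Un_commute)
  have i1: "inj_on (\<lambda>I. insert 0 (Suc ` I)) ?P"
    by (rule inj_on_inverseI[where g = "\<lambda>A. {j. Suc j \<in> A}"]) auto
  have i2: "inj_on (image Suc) ?P"
    by (rule inj_on_inverseI[where g = "\<lambda>A. {j. Suc j \<in> A}"]) auto
  have "(a \<and>\<^sub>f b) (v # vs) = (\<Sum>I\<in>?P. ?t (insert 0 (Suc ` I))) + (\<Sum>I\<in>?P. ?t (Suc ` I))"
    unfolding wedge_def length_Cons P
    by (subst sum.union_disjoint) (auto simp: sum.reindex i1 i2)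
  moreover have "?t (insert 0 (Suc ` I))
      = shuffle_sign I * a (v # nths vs I) * b (nths vs (- I))" for I
    by (simp add: shuffle_sign_insert nths_Cons inj_image_mem_iff Compl_eq)
  moreover have "?t (Suc ` I)
      = shuffle_sign I * ((- 1) ^ length (nths vs I) * a (nths vs I)) * b (v # nths vs (- I))"
    if "I \<in> ?P" for I
  proof -
    from that have I: "I \<subseteq> {..<?n}" by simp
    then have "{i. i < ?n \<and> i \<in> I} = I" by auto
    then have "length (nths vs I) = card I" by (simp add: length_nths)
    moreover have "finite I" using I finite_subset by blast
    ultimately show ?thesis
      by (simp add: shuffle_sign_Suc nths_Cons inj_image_mem_iff Compl_eq)
  qed
  ultimately show ?thesis by (simp add: wedge_def)
qed

text \<open>Recursion on the argument list evaluates a wedge product by rewriting, without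
  enumerating subsets of positions.\<close>

lemmas wedge_simps = wedge_Nil wedge_Cons

lemma coframe_simps [simp]:
  "coframe i [] = 0" "coframe i [v] = v $ i" "coframe i (u # v # vs) = 0"
  by (simp_all add: coframe_def)

lemma e3_apply:
  "e3 i j k [u, v, w] =
     u $ i * (v $ j * w $ k - v $ k * w $ j) - v $ i * (u $ j * w $ k - u $ k * w $ j)
     + w $ i * (u $ j * v $ k - u $ k * v $ j)"
  by (simp add: wedge_simps algebra_simps)

lemma axis_nth_if: "axis i (1::real) $ j = (if j = i then 1 else 0)"
  by (simp add: axis_def)

lemma wedge_zero [simp]: "((\<lambda>us. 0) \<and>\<^sub>f b) vs = 0" "(a \<and>\<^sub>f (\<lambda>us. 0)) vs = 0"
  by (simp_all add: wedge_def)

lemma wedge_minus: "((\<lambda>us. - a us) \<and>\<^sub>f b) vs = - (a \<and>\<^sub>f b) vs"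
  by (simp add: wedge_def sum_negf)

lemma e2_eq_0 [simp]: "e2 i j [] = 0" "e2 i j [u] = 0" "e2 i j (u # v # w # vs) = 0"
  by (simp_all add: wedge_simps)

lemma e3_eq_0 [simp]:
  "e3 i j k [] = 0" "e3 i j k [u] = 0" "e3 i j k [u, v] = 0" "e3 i j k (u # v # w # x # vs) = 0"
  by (simp_all add: wedge_simps)

lemma omega_simps [simp]:
  "omega [] = 0" "omega [u] = 0" "omega (u # v # w # vs) = 0"
  by (simp_all add: omega_def)

lemma lam_pos: "lam > 0"
  unfolding lam_def by (intro ln_gt_zero) (simp add: add_pos_nonneg)

abbreviation frame :: "vector list" where
  "frame \<equiv> [axis 1 1, axis 2 1, axis 3 1, axis 4 1, axis 5 1, axis 6 1]"

lemma omega_apply: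
  "omega [u, v] = (u $ 1 * v $ 2 - u $ 2 * v $ 1 + (u $ 3 * v $ 4 - u $ 4 * v $ 3)
    + (u $ 5 * v $ 6 - u $ 6 * v $ 5)) / lam\<^sup>2"
  by (simp add: omega_def e2_apply field_simps)

lemma volume_omega_frame: "volume omega frame = 1 / lam ^ 6"
  by (simp add: volume_def wedge_simps omega_apply axis_nth_if fact_numeral power_divide
      flip: power_mult)

section \<open>The limiting almost complex structure\<close>

text \<open>The structure for which e^1 + i c e^2, e^3 + i b e^4 and e^5 + i e^6 have type
  (1,0).\<close>

definition std_J :: "real \<Rightarrow> real \<Rightarrow> vector \<Rightarrow> vector" where
  "std_J b c v = (\<chi> i. if i = 1 then - c * v $ 2 else if i = 2 then v $ 1 / c
     else if i = 3 then - b * v $ 4 else if i = 4 then v $ 3 / b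
     else if i = 5 then - v $ 6 else v $ 5)"

lemma std_J_nth [simp]:
  "std_J b c v $ 1 = - c * v $ 2" "std_J b c v $ 2 = v $ 1 / c"
  "std_J b c v $ 3 = - b * v $ 4" "std_J b c v $ 4 = v $ 3 / b"
  "std_J b c v $ 5 = - v $ 6" "std_J b c v $ 6 = v $ 5"
  by (simp_all add: std_J_def)

lemma phi_simps [simp]:
  "phi M N \<alpha> \<beta> \<gamma> \<delta> [] = 0" "phi M N \<alpha> \<beta> \<gamma> \<delta> [u] = 0" "phi M N \<alpha> \<beta> \<gamma> \<delta> [u, v] = 0"
  "phi M N \<alpha> \<beta> \<gamma> \<delta> (u # v # w # x # vs) = 0"
  by (simp_all add: phi_def, simp_all add: wedge_simps)

lemma phi_0_apply:
  "phi 0 0 \<alpha> \<beta> \<gamma> \<delta> [u, v, w] =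
     \<alpha> * (e3 1 3 5 [u, v, w] + e3 1 3 6 [u, v, w]) + \<beta> * (e3 1 4 5 [u, v, w] - e3 1 4 6 [u, v, w])
     + \<gamma> * (e3 2 3 5 [u, v, w] - e3 2 3 6 [u, v, w]) - \<delta> * (e3 2 4 5 [u, v, w] + e3 2 4 6 [u, v, w])"
  by (simp add: phi_def)

text \<open>The assumptions say that \<open>a\<close> has degree 2 and \<open>b\<close> degree 3,
  which leaves ten signed shuffles. With both factors abstract, the 5-form in \<open>calK\<close>
  expands before its entries do.\<close>

lemma wedge_2_3_apply:
  assumes "a [] = 0" "\<And>u. a [u] = 0" "\<And>u v w vs. a (u # v # w # vs) = 0"
    and "b [] = 0" "\<And>u. b [u] = 0" "\<And>u v. b [u, v] = 0" "\<And>u v w x vs. b (u # v # w # x # vs) = 0"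
  shows "(a \<and>\<^sub>f b) [v1, v2, v3, v4, v5] =
      a [v1, v2] * b [v3, v4, v5] - a [v1, v3] * b [v2, v4, v5] + a [v1, v4] * b [v2, v3, v5]
    - a [v1, v5] * b [v2, v3, v4] + a [v2, v3] * b [v1, v4, v5] - a [v2, v4] * b [v1, v3, v5]
    + a [v2, v5] * b [v1, v3, v4] + a [v3, v4] * b [v1, v2, v5] - a [v3, v5] * b [v1, v2, v4]
    + a [v4, v5] * b [v1, v2, v3]"
  by (simp add: wedge_simps assms)

text \<open>Laplace expansion along the first factor: a coframe element accepts exactly one of the
  six vectors.\<close>

lemma coframe_wedge_apply:
  "(coframe i \<and>\<^sub>f b) [v1, v2, v3, v4, v5, v6] =
     v1 $ i * b [v2, v3, v4, v5, v6] - v2 $ i * b [v1, v3, v4, v5, v6]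
   + v3 $ i * b [v1, v2, v4, v5, v6] - v4 $ i * b [v1, v2, v3, v5, v6]
   + v5 $ i * b [v1, v2, v3, v4, v6] - v6 $ i * b [v1, v2, v3, v4, v5]"
  by (simp add: wedge_Nil wedge_minus wedge_Cons[of "coframe i"]
      wedge_Cons[of "\<lambda>us. coframe i (v # us)" for v]
      wedge_Cons[of "\<lambda>us. f us * coframe i (g us)" for f g])

text \<open>The form is the real part of a (3,0)-form for \<open>std_J b c\<close>, so its
  endomorphism is a multiple of \<open>std_J b c\<close>.\<close>

lemma calK_phi_0:
  "b \<noteq> 0 \<Longrightarrow> c \<noteq> 0 \<Longrightarrow>
    calK omega (phi 0 0 1 b c (b * c)) v = (4 * b * c * lam ^ 6) *\<^sub>R std_J b c v"
  unfolding vec_eq_iff forall_6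
  by (simp add: calK_def top_ratio_def Let_def volume_omega_frame coframe_wedge_apply axis_nth_if
      wedge_2_3_apply interior_def, simp add: phi_0_apply e3_apply axis_nth_if, simp add: algebra_simps)

lemma calF_simps [simp]:
  "calF \<omega> \<phi> [] = 0" "calF \<omega> \<phi> [u] = 0" "calF \<omega> \<phi> [u, v] = 0"
  "calF \<omega> \<phi> [u, v, w] = - 2 * \<phi> [calK \<omega> \<phi> u, v, w]"
  "calF \<omega> \<phi> (u # v # w # x # vs) = 0"
  by (simp_all add: calF_def)

text \<open>Stated as minus the square of twice the factor in \<open>calK_phi_0\<close>, so that the
  factor cancels in \<open>calJ\<close>.\<close>

lemma calQ_phi_0:
  assumes "b \<noteq> 0" "c \<noteq> 0"
  shows "calQ omega (phi 0 0 1 b c (b * c)) = - (2 * (4 * b * c * lam ^ 6))\<^sup>2"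
  by (simp add: calQ_def top_ratio_def Let_def volume_omega_frame wedge_simps calK_phi_0[OF assms],
      simp add: axis_nth_if phi_0_apply e3_apply,
      simp add: field_simps assms power2_eq_square)

lemma calJ_phi_0:
  assumes "b > 0" "c > 0"
  shows "calJ omega (phi 0 0 1 b c (b * c)) = std_J b c"
proof -
  \<comment> \<open>Positivity removes the absolute value of the square root and so selects
    \<open>std_J b c\<close> rather than its negative.\<close>
  have "0 < 2 * (4 * b * c * lam ^ 6)" using assms lam_pos by simp
  moreover have "calQ omega (phi 0 0 1 b c (b * c)) = - (2 * (4 * b * c * lam ^ 6))\<^sup>2"
    using assms by (intro calQ_phi_0) auto
  then have "sqrt (- calQ omega (phi 0 0 1 b c (b * c))) = \<bar>2 * (4 * b * c * lam ^ 6)\<bar>"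
    by (simp only: minus_minus real_sqrt_abs)
  ultimately show ?thesis
    using assms lam_pos by (simp add: fun_eq_iff calJ_def calK_phi_0)
qed

lemma compatible_acs_std_J:
  assumes "b > 0" "c > 0"
  shows "compatible_acs omega (std_J b c)"
  unfolding compatible_acs_def
proof (intro conjI allI impI)
  show "linear (std_J b c)"
    by (rule linearI) (simp_all add: vec_eq_iff forall_6 algebra_simps add_divide_distrib)
  show "std_J b c (std_J b c v) = - v" for v
    using assms by (simp add: vec_eq_iff forall_6)
  show "omega [std_J b c u, std_J b c v] = omega [u, v]" for u v
    using assms by (simp add: omega_apply field_simps)
  show "omega [v, std_J b c v] > 0" if "v \<noteq> 0" for v
  proof -
    have "omega [v, std_J b c v] = ((v $ 1)\<^sup>2 / c + c * (v $ 2)\<^sup>2 + (v $ 3)\<^sup>2 / b + b * (v $ 4)\<^sup>2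
        + (v $ 5)\<^sup>2 + (v $ 6)\<^sup>2) / lam\<^sup>2"
      by (simp add: omega_apply power2_eq_square)
    moreover have "v $ 1 \<noteq> 0 \<or> v $ 2 \<noteq> 0 \<or> v $ 3 \<noteq> 0 \<or> v $ 4 \<noteq> 0 \<or> v $ 5 \<noteq> 0 \<or> v $ 6 \<noteq> 0"
      using that by (auto simp: vec_eq_iff forall_6)
    then have "0 < (v $ 1)\<^sup>2 / c + c * (v $ 2)\<^sup>2 + (v $ 3)\<^sup>2 / b + b * (v $ 4)\<^sup>2
        + (v $ 5)\<^sup>2 + (v $ 6)\<^sup>2"
      using assms by (auto simp: add_nonneg_eq_0_iff less_le)
    ultimately show ?thesis using lam_pos by simp
  qed
qed

section \<open>Ricci curvature\<close>

lemma bracket_nth [simp]: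
  "bracket X Y $ 1 = X $ 1 * Y $ 5 - X $ 5 * Y $ 1"
  "bracket X Y $ 2 = X $ 5 * Y $ 2 - X $ 2 * Y $ 5"
  "bracket X Y $ 3 = X $ 3 * Y $ 6 - X $ 6 * Y $ 3"
  "bracket X Y $ 4 = X $ 6 * Y $ 4 - X $ 4 * Y $ 6"
  "bracket X Y $ 5 = 0" "bracket X Y $ 6 = 0"
  by (simp_all add: bracket_def dcoframe_def e2_apply)

text \<open>Koszul formula for the diagonal metric with weights 1/c, c, 1/b, b, 1, 1. The common
  factor 1/\<open>lam\<close>^2 does not affect the connection.\<close>

definition std_conn :: "real \<Rightarrow> real \<Rightarrow> vector \<Rightarrow> vector \<Rightarrow> vector" where
  "std_conn b c X Y = (\<chi> i. if i = 1 then X $ 1 * Y $ 5 else if i = 2 then - X $ 2 * Y $ 5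
     else if i = 3 then X $ 3 * Y $ 6 else if i = 4 then - X $ 4 * Y $ 6
     else if i = 5 then c * X $ 2 * Y $ 2 - X $ 1 * Y $ 1 / c
     else b * X $ 4 * Y $ 4 - X $ 3 * Y $ 3 / b)"

lemma std_conn_nth [simp]:
  "std_conn b c X Y $ 1 = X $ 1 * Y $ 5" "std_conn b c X Y $ 2 = - X $ 2 * Y $ 5"
  "std_conn b c X Y $ 3 = X $ 3 * Y $ 6" "std_conn b c X Y $ 4 = - X $ 4 * Y $ 6"
  "std_conn b c X Y $ 5 = c * X $ 2 * Y $ 2 - X $ 1 * Y $ 1 / c"
  "std_conn b c X Y $ 6 = b * X $ 4 * Y $ 4 - X $ 3 * Y $ 3 / b"
  by (simp_all add: std_conn_def)

text \<open>As an equivalence this rewrites the definite description inside \<open>ricci\<close> to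
  \<open>std_conn b c\<close>. Uniqueness comes from \<open>levi_civita_ex1\<close>, so checking one
  connection suffices.\<close>

lemma levi_civita_std:
  assumes "b > 0" "c > 0"
  shows "levi_civita bracket (\<lambda>u v. omega [u, std_J b c v]) D \<longleftrightarrow> D = std_conn b c"
proof -
  let ?g = "\<lambda>u v. omega [u, std_J b c v]"
  have "\<exists>!D. levi_civita bracket ?g D"
  proof (rule levi_civita_ex1)
    show "bilinear bracket"
      unfolding bilinear_def
      by (intro conjI allI linearI) (simp_all add: vec_eq_iff forall_6 algebra_simps)
    show "bracket Y X = - bracket X Y" for X Y
      by (simp add: vec_eq_iff forall_6)
    show "bilinear ?g"
      unfolding bilinear_def
      by (intro conjI allI linearI)
        (simp_all add: omega_apply algebra_simps add_divide_distrib diff_divide_distrib)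
    show "?g X Y = ?g Y X" for X Y
      by (simp add: omega_apply mult.commute)
    show "?g X X > 0" if "X \<noteq> 0" for X
      using compatible_acs_std_J[OF assms] that by (simp add: compatible_acs_def)
  qed
  moreover have "levi_civita bracket ?g (std_conn b c)"
    unfolding levi_civita_def
  proof (intro conjI allI)
    show "bilinear (std_conn b c)"
      unfolding bilinear_def
      by (intro conjI allI linearI)
        (simp_all add: vec_eq_iff forall_6 algebra_simps add_divide_distrib)
    show "std_conn b c X Y - std_conn b c Y X = bracket X Y" for X Y
      by (simp add: vec_eq_iff forall_6)
    show "?g (std_conn b c X Y) Z + ?g Y (std_conn b c X Z) = 0" for X Y Z
      by (simp add: omega_apply algebra_simps add_divide_distrib diff_divide_distrib)
  qed
  ultimately show ?thesis by blast
qed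

text \<open>The weights \<open>b\<close> and \<open>c\<close> drop out because rescaling each of
  e_1, ..., e_4 is an automorphism of the bracket.\<close>

lemma ricci_std:
  assumes "b > 0" "c > 0"
  shows "ricci bracket (\<lambda>u v. omega [u, std_J b c v]) Y Z = - 2 * (Y $ 5 * Z $ 5 + Y $ 6 * Z $ 6)"
  by (simp add: ricci_def levi_civita_std[OF assms] trace_def matrix_def curvature_def sum_6
      axis_nth_if algebra_simps)

lemma harmonic_acs_std_J:
  assumes "b > 0" "c > 0"
  shows "harmonic_acs bracket omega (std_J b c)"
  using compatible_acs_std_J[OF assms] by (simp add: harmonic_acs_def ricci_std[OF assms])

section \<open>Ordinary differential equations\<close>

text \<open>Separation of variables: \<open>\<tau>\<close>, the antiderivative of 1/f, is the time
  needed to reach a point, and its inverse is the solution. The upper bound on \<open>f\<close>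
  prevents blow-up and makes the solution global.\<close>

lemma scalar_flow_exists:
  fixes f :: "real \<Rightarrow> real"
  assumes cont: "continuous_on UNIV f" and pos: "\<And>x. f x > 0" and bound: "\<And>x. f x \<le> C"
  obtains \<tau> z where "\<tau> 0 = 0" "strict_mono \<tau>"
    "\<And>x. (\<tau> has_real_derivative inverse (f x)) (at x)"
    "\<And>t. (z has_real_derivative f (z t)) (at t)"
    "\<And>x. z (\<tau> x) = x" "\<And>t. \<tau> (z t) = t"
proof -
  have "C > 0" using pos[of 0] bound[of 0] by linarith
  have fne: "f x \<noteq> 0" for x using pos[of x] by simp
  have "continuous_on UNIV (\<lambda>x. inverse (f x))"
    using cont fne by (intro continuous_on_inverse) auto
  then have "\<exists>F. \<forall>x. - \<infinity> < ereal x \<longrightarrow> ereal x < \<infinity> \<longrightarrow> (F has_vector_derivative inverse (f x)) (at x)"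
    by (intro einterval_antiderivative) (auto simp: continuous_on_eq_continuous_at)
  then obtain F where F: "\<And>x. (F has_real_derivative inverse (f x)) (at x)"
    by (auto simp: has_real_derivative_iff_has_vector_derivative)
  define \<tau> where "\<tau> x = F x - F 0" for x
  have d\<tau>: "(\<tau> has_real_derivative inverse (f x)) (at x)" for x
    unfolding \<tau>_def by (auto intro!: derivative_eq_intros F)
  have cont\<tau>: "isCont \<tau> x" for x
    using d\<tau> DERIV_isCont by blast
  have mono: "strict_mono \<tau>"
  proof (rule strict_monoI)
    fix u v :: real assume "u < v"
    then show "\<tau> u < \<tau> v"
      by (rule DERIV_pos_imp_increasing) (use d\<tau> pos in \<open>auto intro!: exI[of _ "inverse (f _)"]\<close>)
  qed
  \<comment> \<open>Since 1/f is at least 1/C, \<open>\<tau>\<close> grows at least linearly, hence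
    is onto.\<close>
  have growth: "(v - u) / C \<le> \<tau> v - \<tau> u" if "u \<le> v" for u v
  proof -
    have "\<tau> u - u / C \<le> \<tau> v - v / C"
    proof (rule DERIV_nonneg_imp_nondecreasing[OF that])
      fix w
      have "((\<lambda>w. \<tau> w - w / C) has_real_derivative inverse (f w) - 1 / C) (at w)"
        using \<open>C > 0\<close> by (auto intro!: derivative_eq_intros d\<tau>)
      moreover have "0 \<le> inverse (f w) - 1 / C"
        using pos[of w] bound[of w] by (simp add: field_simps)
      ultimately show "\<exists>y. ((\<lambda>w. \<tau> w - w / C) has_real_derivative y) (at w) \<and> 0 \<le> y" by blast
    qed
    then show ?thesis by (simp add: diff_divide_distrib)
  qed
  have "surj \<tau>"
    unfolding surj_def
  proof
    fix t :: real
    let ?r = "C * \<bar>t\<bar>"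
    have "\<tau> (- ?r) \<le> t" "t \<le> \<tau> ?r"
      using growth[of "- ?r" 0] growth[of 0 ?r] \<open>C > 0\<close> by (auto simp: \<tau>_def)
    then obtain x where "\<tau> x = t"
      using IVT[of \<tau> "- ?r" t ?r] cont\<tau> \<open>C > 0\<close> by auto
    then show "\<exists>x. t = \<tau> x" by blast
  qed
  define z where "z = inv \<tau>"
  have z\<tau>: "z (\<tau> x) = x" for x
    using mono by (simp add: z_def strict_mono_imp_inj_on)
  have \<tau>z: "\<tau> (z t) = t" for t
    using \<open>surj \<tau>\<close> by (simp add: z_def surj_f_inv_f)
  have "(z has_real_derivative f (z t)) (at t)" for t
  proof -
    have "isCont z (\<tau> (z t))"
      by (rule isCont_inverse_function[of 1]) (auto simp: z\<tau> cont\<tau>)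
    then have "isCont z t" by (simp only: \<tau>z)
    then have "(z has_real_derivative inverse (inverse (f (z t)))) (at t)"
      by (intro DERIV_inverse_function[where f = \<tau> and g = z and x = t and a = "t - 1" and b = "t + 1"])
        (auto simp: \<tau>z d\<tau> fne)
    then show ?thesis by simp
  qed
  then show ?thesis
    using that[of \<tau> z] mono d\<tau> z\<tau> \<tau>z by (simp add: \<tau>_def)
qed

section \<open>Calculus on half-open existence intervals\<close>

abbreviation initial_interval :: "ereal \<Rightarrow> real set" where
  "initial_interval T \<equiv> {t. 0 \<le> t \<and> ereal t < T}"

lemma initial_interval_downward:
  assumes "t \<in> initial_interval T" "0 \<le> s" "s \<le> t"
  shows "s \<in> initial_interval T"
  using assms by (auto intro: order_le_less_trans[of "ereal s" "ereal t"])

lemma convex_initial_interval: "convex (initial_interval T)"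
  by (intro is_interval_convex) (auto simp: is_interval_1 intro: order_le_less_trans[of "ereal _" "ereal _"])

lemma antiderivative_initial_interval:
  fixes h :: "real \<Rightarrow> real"
  assumes "continuous_on (initial_interval T) h"
  obtains H where "H 0 = 0"
    "\<And>t. t \<in> initial_interval T \<Longrightarrow> (H has_real_derivative h t) (at t within initial_interval T)"
proof (rule that[of "\<lambda>t. integral {0..t} h"])
  show "integral {0..0} h = 0" by simp
  fix t assume t: "t \<in> initial_interval T"
  then have "ereal t < T" by simp
  \<comment> \<open>A point beyond \<open>t\<close> yields a compact interval that agrees with the
    existence interval near \<open>t\<close>, also when \<open>t\<close> is 0.\<close>
  then obtain u where u: "ereal t < u" "u < T" using dense by blast
  then obtain r where r: "u = ereal r" by (cases u) auto
  with t u have rT: "r \<in> initial_interval T" by auto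
  have sub: "{0..r} \<subseteq> initial_interval T"
    using initial_interval_downward[OF rT] by auto
  have "((\<lambda>t. integral {0..t} h) has_real_derivative h t) (at t within {0..r})"
    using t u r by (intro integral_has_real_derivative continuous_on_subset[OF assms sub]) auto
  moreover have "at t within {0..r} = at t within initial_interval T"
    by (rule at_within_nhd[of _ "{..<r}"]) (use t u r sub in auto)
  ultimately show "((\<lambda>t. integral {0..t} h) has_real_derivative h t) (at t within initial_interval T)"
    by simp
qed

lemma const_on_initial_interval:
  fixes f :: "real \<Rightarrow> real"
  assumes "\<And>t. t \<in> initial_interval T \<Longrightarrow> (f has_real_derivative 0) (at t within initial_interval T)"
    and "t \<in> initial_interval T"
  shows "f t = f 0"
proof -
  have "0 \<in> initial_interval T"
    using initial_interval_downward[OF assms(2), of 0] assms(2) by simp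
  moreover obtain c where "\<And>x. x \<in> initial_interval T \<Longrightarrow> f x = c"
    using has_field_derivative_zero_constant[of "initial_interval T" f]
      convex_initial_interval assms(1) by metis
  ultimately show ?thesis using assms(2) by metis
qed

lemma mono_on_initial_interval:
  fixes f :: "real \<Rightarrow> real"
  assumes d: "\<And>t. t \<in> initial_interval T \<Longrightarrow>
      (f has_real_derivative f' t) (at t within initial_interval T)"
    and nonneg: "\<And>t. t \<in> initial_interval T \<Longrightarrow> f' t \<ge> 0"
    and "0 \<le> s" "t \<in> initial_interval T" "s \<le> t"
  shows "f s \<le> f t"
proof (cases "s = t")
  case False
  with \<open>s \<le> t\<close> have "s < t" by simp
  have sub: "{s..t} \<subseteq> initial_interval T"
    using initial_interval_downward[OF \<open>t \<in> initial_interval T\<close>] \<open>0 \<le> s\<close> by auto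
  have "\<exists>x\<in>{s<..<t}. f t - f s = (*) (f' x) (t - s)"
  proof (rule mvt_simple[OF \<open>s < t\<close>])
    fix x assume "s \<le> x" "x \<le> t"
    then have "x \<in> {s..t}" by simp
    then have "(f has_real_derivative f' x) (at x within {s..t})"
      using d[of x] sub by (meson DERIV_subset subsetD)
    then show "(f has_derivative (*) (f' x)) (at x within {s..t})"
      by (simp add: has_field_derivative_def)
  qed
  then obtain x where x: "x \<in> {s<..<t}" "f t - f s = f' x * (t - s)"
    by auto
  then have "x \<in> initial_interval T" by (intro subsetD[OF sub]) simp
  then have "f' x \<ge> 0" by (rule nonneg)
  with x \<open>s < t\<close> have "f t - f s \<ge> 0" by simp
  then show ?thesis by simp
qed simp

text \<open>The integrating factor exp(-H) turns \<open>f\<close> into a constant.\<close>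

lemma linear_ode_solution:
  fixes f :: "real \<Rightarrow> real"
  assumes "\<And>t. t \<in> initial_interval T \<Longrightarrow>
      (f has_real_derivative f t * h t) (at t within initial_interval T)"
    and "\<And>t. t \<in> initial_interval T \<Longrightarrow> (H has_real_derivative h t) (at t within initial_interval T)"
    and "H 0 = 0" "t \<in> initial_interval T"
  shows "f t = f 0 * exp (H t)"
proof -
  have "f t * exp (- H t) = f 0 * exp (- H 0)"
  proof (rule const_on_initial_interval[of T "\<lambda>t. f t * exp (- H t)"])
    show "((\<lambda>t. f t * exp (- H t)) has_real_derivative 0) (at t within initial_interval T)"
      if "t \<in> initial_interval T" for t
      using assms(1,2)[OF that] by (auto intro!: derivative_eq_intros)
  qed fact
  then show ?thesis using \<open>H 0 = 0\<close> by (simp add: exp_minus field_simps)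
qed

section \<open>The reduced flow\<close>

locale reduced_flow =
  fixes k A B a b :: real and T :: ereal and x y :: "real \<Rightarrow> real"
  assumes k: "k > 0" and A: "0 \<le> A" "A < a" and B: "0 \<le> B" "B < b" and T: "T > 0"
    and x0: "x 0 = 0" and y0: "y 0 = 0"
    and dx: "t \<in> initial_interval T \<Longrightarrow>
      (x has_real_derivative k * (b * exp (2 * y t) - B)) (at t within initial_interval T)"
    and dy: "t \<in> initial_interval T \<Longrightarrow>
      (y has_real_derivative k * (a * exp (2 * x t) - A)) (at t within initial_interval T)"
begin

lemma zero_in: "0 \<in> initial_interval T"
  using T by (simp add: zero_ereal_def)

text \<open>The product \<open>(a e\<^bsup>2x\<^esup> - A) (b e\<^bsup>2y\<^esup> - B)\<close> is nondecreasing, so neither factor can reach 0.\<close>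

lemma product_pos:
  assumes "t \<in> initial_interval T"
  shows "(a * exp (2 * x t) - A) * (b * exp (2 * y t) - B) > 0"
proof -
  let ?u = "\<lambda>t. a * exp (2 * x t) - A" and ?v = "\<lambda>t. b * exp (2 * y t) - B"
  have "?u 0 * ?v 0 \<le> ?u t * ?v t"
  proof (rule mono_on_initial_interval[of T "\<lambda>t. ?u t * ?v t"])
    fix s assume s: "s \<in> initial_interval T"
    show "((\<lambda>t. ?u t * ?v t) has_real_derivative
        2 * k * (a * exp (2 * x s) * (?v s)\<^sup>2 + b * exp (2 * y s) * (?u s)\<^sup>2))
        (at s within initial_interval T)"
      by (rule derivative_eq_intros dx[OF s] dy[OF s] refl)+
        (simp add: power2_eq_square algebra_simps)
    show "0 \<le> 2 * k * (a * exp (2 * x s) * (?v s)\<^sup>2 + b * exp (2 * y s) * (?u s)\<^sup>2)"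
      using k A B by simp
  qed (use assms in auto)
  moreover have "?u 0 * ?v 0 > 0" using A B x0 y0 by simp
  ultimately show ?thesis by linarith
qed

text \<open>If the first factor became nonpositive it would vanish somewhere before, against
  \<open>product_pos\<close>. The second then inherits its sign from the product.\<close>

lemma factors_pos:
  assumes t: "t \<in> initial_interval T"
  shows "a * exp (2 * x t) - A > 0" "b * exp (2 * y t) - B > 0"
proof -
  let ?u = "\<lambda>t. a * exp (2 * x t) - A"
  have sub: "{0..t} \<subseteq> initial_interval T"
    using initial_interval_downward[OF t] by auto
  have "continuous_on (initial_interval T) x"
    using dx by (rule DERIV_continuous_on)
  then have "continuous_on {0..t} x"
    using sub by (rule continuous_on_subset)
  then have cont: "continuous_on {0..t} ?u"
    by (intro continuous_intros)
  show u: "?u t > 0"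
  proof (rule ccontr)
    assume "\<not> ?u t > 0"
    then obtain s where "s \<in> {0..t}" "?u s = 0"
      using IVT2'[of ?u t 0 0] cont t A x0 by auto
    with product_pos[of s] sub show False by auto
  qed
  show "b * exp (2 * y t) - B > 0"
    using product_pos[OF t] u by (simp add: zero_less_mult_iff)
qed

lemma x_mono:
  assumes "t \<in> initial_interval T" "0 \<le> s" "s \<le> t"
  shows "x s \<le> x t"
  using mono_on_initial_interval[of T x "\<lambda>t. k * (b * exp (2 * y t) - B)" s t] assms dx factors_pos k
  by (simp add: less_imp_le)

lemma x_nonneg: "t \<in> initial_interval T \<Longrightarrow> x t \<ge> 0"
  using x_mono[of t 0] x0 by simp

lemma y_nonneg:
  assumes "t \<in> initial_interval T"
  shows "y t \<ge> 0"
  using mono_on_initial_interval[of T y "\<lambda>t. k * (a * exp (2 * x t) - A)" 0 t] assms dy factors_pos k y0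
  by (simp add: less_imp_le)

text \<open>Both sides have derivative 2k times the product of the two factors of
  \<open>product_pos\<close>, and both vanish at time 0.\<close>

lemma conserved:
  assumes "t \<in> initial_interval T"
  shows "a * exp (2 * x t) - 2 * A * x t - a = b * exp (2 * y t) - 2 * B * y t - b"
proof -
  let ?f = "\<lambda>t. a * exp (2 * x t) - 2 * A * x t - (b * exp (2 * y t) - 2 * B * y t)"
  have "?f t = ?f 0"
  proof (rule const_on_initial_interval[of T ?f])
    fix s assume s: "s \<in> initial_interval T"
    show "(?f has_real_derivative 0) (at s within initial_interval T)"
      by (rule derivative_eq_intros dx[OF s] dy[OF s] refl)+ (simp add: algebra_simps)
  qed fact
  then show ?thesis using x0 y0 by simp
qed

text \<open>Quadratic Taylor bound for exp(2x) in the conserved quantity. Its linear term 2ax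
  absorbs 2Ax because A < a, and what remains gives quadratic growth of x'.\<close>

lemma exp_y_lower:
  assumes "t \<in> initial_interval T"
  shows "b + 2 * a * (x t)\<^sup>2 \<le> b * exp (2 * y t)"
proof -
  have x: "x t \<ge> 0" and y: "y t \<ge> 0" using assms x_nonneg y_nonneg by auto
  have "1 + 2 * x t + (2 * x t)\<^sup>2 / 2 \<le> exp (2 * x t)"
    using x by (intro exp_lower_Taylor_quadratic) simp
  then have "a * (1 + 2 * x t + (2 * x t)\<^sup>2 / 2) \<le> a * exp (2 * x t)"
    using A by (intro mult_left_mono) auto
  moreover have "A * x t \<le> a * x t" "0 \<le> B * y t"
    using A B x y by (auto intro: mult_right_mono)
  ultimately show ?thesis
    using conserved[OF assms] by (simp add: algebra_simps power2_eq_square)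
qed

text \<open>Since \<open>x' \<ge> c (1 + x\<^sup>2)\<close>, the solution \<open>x\<close> dominates \<open>tan (c t)\<close>.\<close>

lemma T_finite: "T < \<infinity>"
proof (rule ccontr)
  assume "\<not> T < \<infinity>"
  then have T: "T = \<infinity>" by simp
  \<comment> \<open>Chosen so that k((b - B) + 2ax^2) is at least c(1 + x^2).\<close>
  define c where "c = k * min (b - B) (2 * a)"
  have c: "c > 0" using k A B by (simp add: c_def)
  \<comment> \<open>At this time ct equals pi/2, a value that arctan never attains.\<close>
  define t where "t = pi / (2 * c)"
  have "t \<ge> 0" using c by (simp add: t_def)
  have "arctan (x 0) - c * 0 \<le> arctan (x t) - c * t"
  proof (rule mono_on_initial_interval[of T "\<lambda>t. arctan (x t) - c * t"])
    fix s assume s: "s \<in> initial_interval T"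
    show "((\<lambda>t. arctan (x t) - c * t) has_real_derivative
        k * (b * exp (2 * y s) - B) / (1 + (x s)\<^sup>2) - c) (at s within initial_interval T)"
      by (rule derivative_eq_intros dx[OF s] refl)+ (simp add: divide_inverse)
    have "min (b - B) (2 * a) * (x s)\<^sup>2 \<le> 2 * a * (x s)\<^sup>2"
      by (intro mult_right_mono) auto
    then have "k * (min (b - B) (2 * a) * (1 + (x s)\<^sup>2)) \<le> k * ((b - B) + 2 * a * (x s)\<^sup>2)"
      using k by (intro mult_left_mono) (auto simp: distrib_left)
    then have "c * (1 + (x s)\<^sup>2) \<le> k * ((b - B) + 2 * a * (x s)\<^sup>2)"
      by (simp add: c_def mult.assoc)
    also have "\<dots> \<le> k * (b * exp (2 * y s) - B)"
      using exp_y_lower[OF s] k by (intro mult_left_mono) auto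
    finally show "0 \<le> k * (b * exp (2 * y s) - B) / (1 + (x s)\<^sup>2) - c"
      by (simp add: pos_le_divide_eq add_pos_nonneg)
  qed (use \<open>t \<ge> 0\<close> T in auto)
  then have "c * t \<le> arctan (x t)" using x0 by simp
  moreover have "c * t = pi / 2" using c by (simp add: t_def)
  ultimately show False using arctan_ubound[of "x t"] by simp
qed

text \<open>The conserved quantity gives \<open>y = Y x\<close>, so \<open>x\<close> solves a scalar autonomous equation \<open>x' = f x\<close>.
  Truncating \<open>f\<close> above the bound on \<open>x\<close> yields a global solution, which extends \<open>x\<close> beyond \<open>T\<close>.\<close>

lemma extension:
  assumes bounded: "\<And>t. t \<in> initial_interval T \<Longrightarrow> x t \<le> X"
  shows "\<exists>T' z w. T < T' \<and> (\<forall>t\<in>initial_interval T. z t = x t \<and> w t = y t) \<and>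
    (\<forall>t\<in>initial_interval T'. (z has_real_derivative k * (b * exp (2 * w t) - B)) (at t) \<and>
      (w has_real_derivative k * (a * exp (2 * z t) - A)) (at t))"
proof -
  \<comment> \<open>Truncating at 0 keeps \<open>g\<close> above b - B > 0 on the whole line;
    nothing changes along the solution, where y is nonnegative.\<close>
  define g where "g v = b * exp (2 * max v 0) - B" for v
  have g_ge: "b - B \<le> g v" for v
    using B by (simp add: g_def mult_le_cancel_left1)
  then have g_pos: "g v > 0" for v
    using B by (intro less_le_trans[OF _ g_ge]) simp
  have g_cont: "continuous_on UNIV g"
    unfolding g_def by (intro continuous_intros)
  \<comment> \<open>Applied to 1/g, the lemma yields an antiderivative \<open>\<sigma>\<close> of
    \<open>g\<close> and its inverse \<open>G\<close>. At nonnegative arguments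
    \<open>\<sigma>\<close> is half of the y-side of \<open>conserved\<close>.\<close>
  obtain \<sigma> G where \<sigma>: "\<sigma> 0 = 0" "strict_mono \<sigma>"
      "\<And>v. (\<sigma> has_real_derivative inverse (inverse (g v))) (at v)"
      "\<And>s. (G has_real_derivative inverse (g (G s))) (at s)"
      "\<And>v. G (\<sigma> v) = v" "\<And>s. \<sigma> (G s) = s"
  proof (rule scalar_flow_exists[of "\<lambda>v. inverse (g v)" "inverse (b - B)"])
    show "continuous_on UNIV (\<lambda>v. inverse (g v))"
      using g_cont g_pos by (intro continuous_on_inverse) (auto simp: less_imp_neq[symmetric])
    show "inverse (g v) \<le> inverse (b - B)" for v
      using g_ge B by (intro le_imp_inverse_le) auto
  qed (use g_pos in auto)
  \<comment> \<open>Half of the x-side of \<open>conserved\<close>, so the conservation law reads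
    \<open>\<sigma>\<close> y = H x.\<close>
  define H where "H u = a / 2 * exp (2 * u) - A * u - a / 2" for u
  define Y where "Y u = G (H u)" for u
  have dH: "(H has_real_derivative a * exp (2 * u) - A) (at u)" for u
    unfolding H_def by (rule derivative_eq_intros refl)+ simp
  have dY: "(Y has_real_derivative inverse (g (Y u)) * (a * exp (2 * u) - A)) (at u)" for u
    unfolding Y_def by (rule DERIV_chain2[OF \<sigma>(4) dH])
  have H_nonneg: "H u \<ge> 0" if "u \<ge> 0" for u
  proof -
    have "a * (1 + 2 * u) \<le> a * exp (2 * u)"
      using A exp_ge_add_one_self[of "2 * u"] by (intro mult_left_mono) auto
    moreover have "A * u \<le> a * u" using A that by (intro mult_right_mono) auto
    ultimately show ?thesis by (simp add: H_def algebra_simps)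
  qed
  have Y_nonneg: "Y u \<ge> 0" if "u \<ge> 0" for u
    using H_nonneg[OF that] \<sigma>(1,6) strict_mono_less_eq[OF \<sigma>(2), of 0 "Y u"] by (simp add: Y_def)
  have Y_x: "y t = Y (x t)" if t: "t \<in> initial_interval T" for t
  proof -
    have "\<sigma> (y t) - H (x t) = \<sigma> (y 0) - H (x 0)"
    proof (rule const_on_initial_interval[of T "\<lambda>t. \<sigma> (y t) - H (x t)"])
      fix s assume s: "s \<in> initial_interval T"
      have "((\<lambda>t. \<sigma> (y t)) has_real_derivative inverse (inverse (g (y s))) * (k * (a * exp (2 * x s) - A)))
          (at s within initial_interval T)"
        by (rule DERIV_chain2[OF \<sigma>(3) dy[OF s]])
      moreover have "((\<lambda>t. H (x t)) has_real_derivative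
          (a * exp (2 * x s) - A) * (k * (b * exp (2 * y s) - B))) (at s within initial_interval T)"
        by (rule DERIV_chain2[OF dH dx[OF s]])
      moreover have "g (y s) = b * exp (2 * y s) - B"
        using y_nonneg[OF s] by (simp add: g_def)
      ultimately show "((\<lambda>t. \<sigma> (y t) - H (x t)) has_real_derivative 0) (at s within initial_interval T)"
        by (auto intro!: derivative_eq_intros)
    qed fact
    then have "\<sigma> (y t) = H (x t)" using x0 y0 \<sigma>(1) by (simp add: H_def)
    then show ?thesis by (metis Y_def \<sigma>(5))
  qed
  have X: "X \<ge> 0" using bounded[OF zero_in] x0 by simp
  \<comment> \<open>Clamping makes the right-hand side bounded; the margin 1 above \<open>X\<close>
    leaves room to continue beyond \<open>T\<close>.\<close>
  define cl where "cl u = max 0 (min u (X + 1))" for u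
  have cl_in: "cl u \<in> {0..X + 1}" for u using X by (auto simp: cl_def)
  define f where "f u = k * g (Y (cl u))" for u
  have contY: "continuous_on UNIV Y"
    using dY by (auto intro!: DERIV_isCont simp: continuous_on_eq_continuous_at)
  have cont_gY: "continuous_on UNIV (\<lambda>u. k * g (Y u))"
    by (intro continuous_intros continuous_on_compose2[OF g_cont contY]) auto
  have f_cont: "continuous_on UNIV f"
    unfolding f_def cl_def
    by (intro continuous_on_compose2[OF cont_gY] continuous_intros) auto
  have "continuous_on {0..X + 1} (\<lambda>u. k * g (Y u))"
    using cont_gY by (rule continuous_on_subset) simp
  then have "\<exists>m\<in>{0..X + 1}. \<forall>u\<in>{0..X + 1}. k * g (Y u) \<le> k * g (Y m)"
    using X by (intro continuous_attains_sup) auto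
  then obtain m where "\<And>u. u \<in> {0..X + 1} \<Longrightarrow> k * g (Y u) \<le> k * g (Y m)"
    by blast
  then have f_le: "f u \<le> k * g (Y m)" for u
    using cl_in by (simp add: f_def)
  obtain \<tau> z where \<tau>: "\<tau> 0 = 0" "strict_mono \<tau>"
      "\<And>u. (\<tau> has_real_derivative inverse (f u)) (at u)"
      "\<And>t. (z has_real_derivative f (z t)) (at t)"
      "\<And>u. z (\<tau> u) = u" "\<And>t. \<tau> (z t) = t"
    using scalar_flow_exists[of f, OF f_cont _ f_le] g_pos k by (auto simp: f_def)
  \<comment> \<open>The time needed to reach x(t) is t, so x coincides with the global solution
    \<open>z\<close> up to \<open>T\<close>.\<close>
  have \<tau>x: "\<tau> (x t) = t" if t: "t \<in> initial_interval T" for t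
  proof -
    have "\<tau> (x t) - t = \<tau> (x 0) - 0"
    proof (rule const_on_initial_interval[of T "\<lambda>t. \<tau> (x t) - t"])
      fix s assume s: "s \<in> initial_interval T"
      have "((\<lambda>t. \<tau> (x t)) has_real_derivative inverse (f (x s)) * (k * (b * exp (2 * y s) - B)))
          (at s within initial_interval T)"
        by (rule DERIV_chain2[OF \<tau>(3) dx[OF s]])
      moreover have "cl (x s) = x s"
        using x_nonneg[OF s] bounded[OF s] by (simp add: cl_def)
      then have "f (x s) = k * (b * exp (2 * y s) - B)"
        using y_nonneg[OF s] Y_x[OF s, symmetric] by (simp add: f_def g_def)
      moreover have "k * (b * exp (2 * y s) - B) \<noteq> 0"
        using k factors_pos(2)[OF s] by simp
      ultimately have "((\<lambda>t. \<tau> (x t)) has_real_derivative 1) (at s within initial_interval T)"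
        by (metis left_inverse)
      then show "((\<lambda>t. \<tau> (x t) - t) has_real_derivative 0) (at s within initial_interval T)"
        by (auto intro!: derivative_eq_intros)
    qed fact
    then show ?thesis using x0 \<tau>(1) by simp
  qed
  have "T \<le> ereal (\<tau> X)"
  proof (rule ccontr)
    assume "\<not> T \<le> ereal (\<tau> X)"
    then have "ereal (\<tau> X) < T" by simp
    then obtain r where r: "ereal (\<tau> X) < r" "r < T" using dense by blast
    then obtain t where t: "r = ereal t" by (cases r) auto
    have "\<tau> X \<ge> 0" using strict_mono_less_eq[OF \<tau>(2), of 0 X] X \<tau>(1) by simp
    with r t have "t \<in> initial_interval T" by auto
    then have "t \<le> \<tau> X"
      using \<tau>x[of t] bounded[of t] strict_mono_less_eq[OF \<tau>(2), of "x t" X] by simp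
    with r t show False by simp
  qed
  also have "ereal (\<tau> X) < ereal (\<tau> (X + 1))"
    using strict_mono_less[OF \<tau>(2)] by simp
  finally have T': "T < ereal (\<tau> (X + 1))" .
  show ?thesis
  proof (rule exI[of _ "ereal (\<tau> (X + 1))"], rule exI[of _ z], rule exI[of _ "\<lambda>t. Y (z t)"],
      intro conjI ballI)
    show "T < ereal (\<tau> (X + 1))" by (fact T')
    fix t assume t: "t \<in> initial_interval T"
    show "z t = x t" "Y (z t) = y t"
      using \<tau>x[OF t] \<tau>(5)[of "x t"] Y_x[OF t] by simp_all
  next
    fix t assume t: "t \<in> initial_interval (ereal (\<tau> (X + 1)))"
    \<comment> \<open>Before time \<open>\<tau> (X + 1)\<close> the solution \<open>z\<close> stays
      where neither truncation acts.\<close>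
    have "z t \<ge> 0" "z t < X + 1"
      using t \<tau>(1,6) strict_mono_less_eq[OF \<tau>(2), of 0 "z t"] strict_mono_less[OF \<tau>(2), of "z t" "X + 1"]
      by auto
    then have "cl (z t) = z t" "Y (z t) \<ge> 0" using Y_nonneg by (auto simp: cl_def)
    then have f: "f (z t) = k * (b * exp (2 * Y (z t)) - B)" "f (z t) = k * g (Y (z t))"
      by (simp_all add: f_def g_def)
    show "(z has_real_derivative k * (b * exp (2 * Y (z t)) - B)) (at t)"
      using \<tau>(4)[of t] f by simp
    have "((\<lambda>t. Y (z t)) has_real_derivative inverse (g (Y (z t))) * (a * exp (2 * z t) - A) * f (z t)) (at t)"
      by (rule DERIV_chain2[OF dY \<tau>(4)])
    moreover have "inverse (g (Y (z t))) * (a * exp (2 * z t) - A) * f (z t) = k * (a * exp (2 * z t) - A)"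
      using g_pos[of "Y (z t)"] unfolding f(2) by (simp add: field_simps)
    ultimately show "((\<lambda>t. Y (z t)) has_real_derivative k * (a * exp (2 * z t) - A)) (at t)"
      by (simp only:)
  qed
qed

section \<open>Asymptotics at the singular time\<close>

context
  fixes r :: real
  assumes T_eq: "T = ereal r" and unbounded: "\<And>X. \<exists>t\<in>initial_interval T. X < x t"
begin

lemma eventually_initial_interval: "eventually (\<lambda>t. t \<in> initial_interval T) (at_left r)"
  using T T_eq by (intro eventually_at_leftI[of 0]) auto

lemma x_at_top: "filterlim x at_top (at_left r)"
  unfolding filterlim_at_top
proof
  fix X
  obtain s where s: "s \<in> initial_interval T" "X < x s" using unbounded by blast
  show "eventually (\<lambda>t. X \<le> x t) (at_left r)"
  proof (rule eventually_at_leftI[of s])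
    fix t assume t: "t \<in> {s<..<r}"
    then have "x s \<le> x t" using s T_eq by (intro x_mono) auto
    with s show "X \<le> x t" by simp
  qed (use s T_eq in auto)
qed

lemma y_at_top: "filterlim y at_top (at_left r)"
  unfolding filterlim_at_top
proof
  fix Z
  \<comment> \<open>The bound 1 gives x <= x^2; the other bound then makes 2ax^2 at least b exp(2Z),
    as \<open>exp_y_lower\<close> needs.\<close>
  have "eventually (\<lambda>t. max 1 (b / (2 * a) * exp (2 * Z)) \<le> x t) (at_left r)"
    using x_at_top unfolding filterlim_at_top by blast
  then show "eventually (\<lambda>t. Z \<le> y t) (at_left r)"
    using eventually_initial_interval
  proof eventually_elim
    case (elim t)
    have "x t \<le> (x t)\<^sup>2" using elim by (simp add: power2_eq_square)
    with elim have "b / (2 * a) * exp (2 * Z) \<le> (x t)\<^sup>2" by simp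
    then have "b * exp (2 * Z) \<le> 2 * a * (x t)\<^sup>2" using A by (simp add: field_simps)
    also have "\<dots> \<le> b * exp (2 * y t)" using exp_y_lower[OF elim(2)] B by simp
    finally show ?case using B by simp
  qed
qed

text \<open>Divide the two sides of \<open>conserved\<close>, rearranged, by exp(2x) and exp(2y).
  Linear terms become negligible, so the quotients tend to a and b.\<close>

lemma exp_diff_limit: "((\<lambda>t. exp (y t - x t)) \<longlongrightarrow> sqrt (a / b)) (at_left r)"
proof -
  have lim: "((\<lambda>t. 2 * w t / exp (2 * w t)) \<longlongrightarrow> 0) (at_left r)"
      "((\<lambda>t. inverse (exp (2 * w t))) \<longlongrightarrow> 0) (at_left r)"
    if w: "filterlim w at_top (at_left r)" for w :: "real \<Rightarrow> real"
  proof -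
    have w2: "filterlim (\<lambda>t. 2 * w t) at_top (at_left r)"
      using w by (intro filterlim_tendsto_pos_mult_at_top[OF tendsto_const]) auto
    have "((\<lambda>u::real. u ^ 1 / exp u) \<longlongrightarrow> 0) at_top" by (rule tendsto_power_div_exp_0)
    from filterlim_compose[OF this w2]
    show "((\<lambda>t. 2 * w t / exp (2 * w t)) \<longlongrightarrow> 0) (at_left r)" by simp
    show "((\<lambda>t. inverse (exp (2 * w t))) \<longlongrightarrow> 0) (at_left r)"
      by (intro tendsto_inverse_0_at_top filterlim_compose[OF exp_at_top w2])
  qed
  have "((\<lambda>t. (a - A * (2 * x t / exp (2 * x t)) - (a - b) * inverse (exp (2 * x t)))
      / (b - B * (2 * y t / exp (2 * y t)))) \<longlongrightarrow> (a - A * 0 - (a - b) * 0) / (b - B * 0)) (at_left r)"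
    using B by (intro tendsto_intros lim x_at_top y_at_top) auto
  moreover have "eventually (\<lambda>t. (a - A * (2 * x t / exp (2 * x t)) - (a - b) * inverse (exp (2 * x t)))
      / (b - B * (2 * y t / exp (2 * y t))) = exp (2 * (y t - x t))) (at_left r)"
    using eventually_initial_interval
  proof eventually_elim
    case (elim t)
    \<comment> \<open>The common value of both sides of the conservation law; being positive, it
      cancels from the quotient.\<close>
    define D where "D = b * exp (2 * y t) - 2 * B * y t"
    have "b * (1 + 2 * y t) \<le> b * exp (2 * y t)"
      using exp_ge_add_one_self B by (intro mult_left_mono) auto
    moreover have "B * y t \<le> b * y t"
      using B y_nonneg[OF elim] by (intro mult_right_mono) auto
    ultimately have den: "D > 0"
      using B by (simp add: D_def algebra_simps)
    have num: "D = a * exp (2 * x t) - 2 * A * x t - (a - b)"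
      using conserved[OF elim] by (simp add: D_def)
    have "a - A * (2 * x t / exp (2 * x t)) - (a - b) * inverse (exp (2 * x t)) = D / exp (2 * x t)"
      unfolding num by (simp add: field_simps)
    moreover have "b - B * (2 * y t / exp (2 * y t)) = D / exp (2 * y t)"
      by (simp add: D_def field_simps)
    ultimately show ?case
      using den by (simp only: right_diff_distrib exp_diff) simp
  qed
  ultimately have "((\<lambda>t. exp (2 * (y t - x t))) \<longlongrightarrow> a / b) (at_left r)"
    by (simp add: filterlim_cong[OF refl refl])
  then have "((\<lambda>t. sqrt (exp (2 * (y t - x t)))) \<longlongrightarrow> sqrt (a / b)) (at_left r)"
    by (rule tendsto_real_sqrt)
  moreover have "sqrt (exp (2 * u)) = exp u" for u :: real
    by (rule real_sqrt_unique) (simp_all add: exp_double)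
  ultimately show ?thesis by (simp only:)
qed

end

end

section \<open>The limit of the flow\<close>

text \<open>The form is affine in its four varying coefficients, and the fixed \<open>M\<close>,
  \<open>N\<close> part is killed by 1/\<open>\<alpha>\<close>.\<close>

lemma phi_scaled_limit:
  assumes lim: "((\<lambda>t. inverse (\<alpha> t)) \<longlongrightarrow> 0) F" "((\<lambda>t. \<beta> t / \<alpha> t) \<longlongrightarrow> b) F"
      "((\<lambda>t. \<gamma> t / \<alpha> t) \<longlongrightarrow> c) F" "((\<lambda>t. \<delta> t / \<alpha> t) \<longlongrightarrow> d) F"
    and nz: "eventually (\<lambda>t. \<alpha> t \<noteq> 0) F"
  shows "((\<lambda>t. inverse (\<alpha> t) * phi M N (\<alpha> t) (\<beta> t) (\<gamma> t) (\<delta> t) vs) \<longlongrightarrow> phi 0 0 1 b c d vs) F"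
proof -
  define P1 where "P1 = e3 1 3 5 vs + e3 1 3 6 vs"
  define P2 where "P2 = e3 1 4 5 vs - e3 1 4 6 vs"
  define P3 where "P3 = e3 2 3 5 vs - e3 2 3 6 vs"
  define P4 where "P4 = e3 2 4 5 vs + e3 2 4 6 vs"
  define W where "W = ((\<lambda>us. M * coframe 5 us + N * coframe 6 us) \<and>\<^sub>f (\<lambda>us. e2 1 2 us - e2 3 4 us)) vs"
  have "((\<lambda>t. P1 + \<beta> t / \<alpha> t * P2 + \<gamma> t / \<alpha> t * P3 - \<delta> t / \<alpha> t * P4 + inverse (\<alpha> t) * W)
      \<longlongrightarrow> P1 + b * P2 + c * P3 - d * P4 + 0 * W) F"
    by (intro tendsto_intros lim)
  moreover have "eventually (\<lambda>t. P1 + \<beta> t / \<alpha> t * P2 + \<gamma> t / \<alpha> t * P3 - \<delta> t / \<alpha> t * P4 + inverse (\<alpha> t) * W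
      = inverse (\<alpha> t) * phi M N (\<alpha> t) (\<beta> t) (\<gamma> t) (\<delta> t) vs) F"
    using nz
  proof eventually_elim
    case (elim t)
    have "phi M N (\<alpha> t) (\<beta> t) (\<gamma> t) (\<delta> t) vs = \<alpha> t * P1 + \<beta> t * P2 + \<gamma> t * P3 - \<delta> t * P4 + W"
      unfolding phi_def P1_def P2_def P3_def P4_def W_def ..
    then show ?case using elim by (simp only:) (simp add: field_simps)
  qed
  moreover have "phi 0 0 1 b c d vs = P1 + b * P2 + c * P3 - d * P4 + 0 * W"
    by (simp add: phi_def P1_def P2_def P3_def P4_def)
  ultimately show ?thesis
    by (simp only: Lim_transform_eventually)
qed

text \<open>With p = \<open>\<alpha> * \<delta>\<close> and q = \<open>\<beta> * \<gamma>\<close>,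
  condition (3) reads pB + qA < 4pq. Drop either nonnegative term on the left and cancel p or
  q.\<close>

lemma positive_data_bounds:
  assumes "positive_data M N \<alpha> \<beta> \<gamma> \<delta>"
  shows "(M + N)\<^sup>2 < 4 * (\<alpha> * \<delta>)" "(M - N)\<^sup>2 < 4 * (\<beta> * \<gamma>)"
    and "\<alpha> \<noteq> 0" "\<alpha> * \<delta> > 0" "\<beta> * \<gamma> > 0" "\<beta> / \<alpha> > 0" "\<gamma> / \<alpha> > 0"
proof -
  show p: "\<alpha> \<noteq> 0" "\<alpha> * \<delta> > 0" "\<beta> * \<gamma> > 0" "\<beta> / \<alpha> > 0" "\<gamma> / \<alpha> > 0"
    using assms by (auto simp: positive_data_def mult_neg_neg divide_neg_neg)
  define p q A B where "p = \<alpha> * \<delta>" and "q = \<beta> * \<gamma>" and "A = (M + N)\<^sup>2" and "B = (M - N)\<^sup>2"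
  have pq: "p > 0" "q > 0" and AB: "A \<ge> 0" "B \<ge> 0"
    using p by (simp_all add: p_def q_def A_def B_def)
  have "- 4 * \<alpha> * \<beta> * \<gamma> * \<delta> + \<alpha> * \<delta> * (M - N)\<^sup>2 + \<beta> * \<gamma> * (M + N)\<^sup>2 < 0"
    using assms by (simp add: positive_data_def)
  then have *: "p * B + q * A < 4 * p * q"
    by (simp add: p_def q_def A_def B_def algebra_simps)
  have "q * A \<ge> 0" "p * B \<ge> 0" using pq AB by simp_all
  with * have "p * B < p * (4 * q)" "q * A < q * (4 * p)" by (simp_all add: algebra_simps)
  then show "(M + N)\<^sup>2 < 4 * (\<alpha> * \<delta>)" "(M - N)\<^sup>2 < 4 * (\<beta> * \<gamma>)"
    using pq by (simp_all add: mult_less_cancel_left_pos p_def q_def A_def B_def)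
qed

theorem proposition4p9:
  fixes M N \<alpha>0 \<beta>0 \<gamma>0 \<delta>0 :: real
    and \<alpha> \<beta> \<gamma> \<delta> :: "real \<Rightarrow> real" and T :: ereal
  assumes "positive_data M N \<alpha>0 \<beta>0 \<gamma>0 \<delta>0"
    and "maximal_flow_solution M N T \<alpha> \<beta> \<gamma> \<delta>"
    and "\<alpha> 0 = \<alpha>0" "\<beta> 0 = \<beta>0" "\<gamma> 0 = \<gamma>0" "\<delta> 0 = \<delta>0"
  shows "T < \<infinity> \<and>
    (\<exists>\<phi>_inf :: form.
       (\<forall>vs. ((\<lambda>t. inverse (\<alpha> t) * phi M N (\<alpha> t) (\<beta> t) (\<gamma> t) (\<delta> t) vs) \<longlongrightarrow> \<phi>_inf vs)
               (at_left (real_of_ereal T))) \<and>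
       calQ omega \<phi>_inf < 0 \<and>
       harmonic_acs bracket omega (calJ omega \<phi>_inf))"
proof -
  note pos = positive_data_bounds[OF assms(1)]
  let ?I = "initial_interval T"
  define k where "k = 4 * lam\<^sup>2"
  define A where "A = (M + N)\<^sup>2"
  define B where "B = (M - N)\<^sup>2"
  have T: "T > 0" and flow: "flow_solution M N T \<alpha> \<beta> \<gamma> \<delta>"
    and maximal: "\<And>T' \<alpha>' \<beta>' \<gamma>' \<delta>'. T < T' \<Longrightarrow> flow_solution M N T' \<alpha>' \<beta>' \<gamma>' \<delta>' \<Longrightarrow>
      \<exists>t\<in>?I. \<not> (\<alpha>' t = \<alpha> t \<and> \<beta>' t = \<beta> t \<and> \<gamma>' t = \<gamma> t \<and> \<delta>' t = \<delta> t)"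
    using assms(2) unfolding maximal_flow_solution_def by auto
  have ode: "(\<alpha> has_real_derivative \<alpha> t * (k * (4 * (\<beta> t * \<gamma> t) - B))) (at t within ?I)"
    "(\<beta> has_real_derivative \<beta> t * (k * (4 * (\<alpha> t * \<delta> t) - A))) (at t within ?I)"
    "(\<gamma> has_real_derivative \<gamma> t * (k * (4 * (\<alpha> t * \<delta> t) - A))) (at t within ?I)"
    "(\<delta> has_real_derivative \<delta> t * (k * (4 * (\<beta> t * \<gamma> t) - B))) (at t within ?I)"
    if "t \<in> ?I" for t
    using flow that by (simp_all add: flow_solution_def Let_def k_def A_def B_def mult_ac)
  have cont: "continuous_on ?I \<alpha>" "continuous_on ?I \<beta>" "continuous_on ?I \<gamma>" "continuous_on ?I \<delta>"
    by (rule DERIV_continuous_on, erule ode)+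
  have "continuous_on ?I (\<lambda>t. k * (4 * (\<beta> t * \<gamma> t) - B))"
    by (intro continuous_intros cont)
  \<comment> \<open>\<open>x\<close> integrates the common logarithmic derivative of
    \<open>\<alpha>\<close> and \<open>\<delta>\<close>; \<open>y\<close> below does so for
    \<open>\<beta>\<close> and \<open>\<gamma>\<close>.\<close>
  from antiderivative_initial_interval[OF this] obtain x where x: "x 0 = 0" "\<And>t. t \<in> ?I \<Longrightarrow>
      (x has_real_derivative k * (4 * (\<beta> t * \<gamma> t) - B)) (at t within ?I)"
    by blast
  have "continuous_on ?I (\<lambda>t. k * (4 * (\<alpha> t * \<delta> t) - A))"
    by (intro continuous_intros cont)
  from antiderivative_initial_interval[OF this] obtain y where y: "y 0 = 0" "\<And>t. t \<in> ?I \<Longrightarrow>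
      (y has_real_derivative k * (4 * (\<alpha> t * \<delta> t) - A)) (at t within ?I)"
    by blast
  have sol: "\<alpha> t = \<alpha>0 * exp (x t)" "\<beta> t = \<beta>0 * exp (y t)"
    "\<gamma> t = \<gamma>0 * exp (y t)" "\<delta> t = \<delta>0 * exp (x t)" if "t \<in> ?I" for t
    using linear_ode_solution[OF ode(1) x(2,1) that] linear_ode_solution[OF ode(2) y(2,1) that]
      linear_ode_solution[OF ode(3) y(2,1) that] linear_ode_solution[OF ode(4) x(2,1) that] assms(3-6)
    by simp_all
  have exp2: "u * exp z * (v * exp z) = u * v * exp (2 * z)" for u v z :: real
    by (simp add: exp_double power2_eq_square)
  interpret reduced_flow k A B "4 * (\<alpha>0 * \<delta>0)" "4 * (\<beta>0 * \<gamma>0)" T x y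
  proof
    show "k > 0" using lam_pos by (simp add: k_def)
    show "(x has_real_derivative k * (4 * (\<beta>0 * \<gamma>0) * exp (2 * y t) - B)) (at t within ?I)"
      if "t \<in> ?I" for t
      using x(2)[OF that] unfolding sol[OF that] exp2 by (simp only: mult.assoc)
    show "(y has_real_derivative k * (4 * (\<alpha>0 * \<delta>0) * exp (2 * x t) - A)) (at t within ?I)"
      if "t \<in> ?I" for t
      using y(2)[OF that] unfolding sol[OF that] exp2 by (simp only: mult.assoc)
  qed (use T x y pos in \<open>auto simp: A_def B_def\<close>)
  obtain r where r: "T = ereal r"
    using T T_finite by (cases T) auto
  \<comment> \<open>If x were bounded, exponentiating the continuation from \<open>extension\<close>
    would contradict maximality of \<open>T\<close>.\<close>
  have unbounded: "\<exists>t\<in>?I. X < x t" for X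
  proof (rule ccontr)
    assume "\<not> (\<exists>t\<in>?I. X < x t)"
    then have "x t \<le> X" if "t \<in> ?I" for t using that not_less by blast
    from extension[OF this] obtain T' z w where ext: "T < T'" "\<And>t. t \<in> ?I \<Longrightarrow> z t = x t \<and> w t = y t"
      "\<And>t. t \<in> initial_interval T' \<Longrightarrow>
        (z has_real_derivative k * (4 * (\<beta>0 * \<gamma>0) * exp (2 * w t) - B)) (at t)"
      "\<And>t. t \<in> initial_interval T' \<Longrightarrow>
        (w has_real_derivative k * (4 * (\<alpha>0 * \<delta>0) * exp (2 * z t) - A)) (at t)"
      by blast
    have "flow_solution M N T' (\<lambda>t. \<alpha>0 * exp (z t)) (\<lambda>t. \<beta>0 * exp (w t))
        (\<lambda>t. \<gamma>0 * exp (w t)) (\<lambda>t. \<delta>0 * exp (z t))"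
      unfolding flow_solution_def Let_def
    proof
      fix t assume t: "t \<in> initial_interval T'"
      note d = ext(3,4)[OF t, THEN DERIV_subset[OF _ subset_UNIV], of "initial_interval T'"]
      have quad: "4 * (u * exp v) * (u' * exp v) = 4 * (u * u') * exp (2 * v)" for u u' v :: real
        by (simp add: exp2[symmetric])
      have dz: "((\<lambda>t. u * exp (z t)) has_real_derivative 4 * lam\<^sup>2 * (u * exp (z t)) *
            (4 * (\<beta>0 * exp (w t)) * (\<gamma>0 * exp (w t)) - (M - N)\<^sup>2)) (at t within initial_interval T')"
        for u
        by (rule derivative_eq_intros d(1) refl)+ (simp only: quad k_def B_def, simp)
      have dw: "((\<lambda>t. u * exp (w t)) has_real_derivative 4 * lam\<^sup>2 * (u * exp (w t)) *
            (4 * (\<alpha>0 * exp (z t)) * (\<delta>0 * exp (z t)) - (M + N)\<^sup>2)) (at t within initial_interval T')"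
        for u
        by (rule derivative_eq_intros d(2) refl)+ (simp only: quad k_def A_def, simp)
      show "((\<lambda>t. \<alpha>0 * exp (z t)) has_real_derivative 4 * lam\<^sup>2 * (\<alpha>0 * exp (z t)) *
            (4 * (\<beta>0 * exp (w t)) * (\<gamma>0 * exp (w t)) - (M - N)\<^sup>2)) (at t within initial_interval T') \<and>
        ((\<lambda>t. \<beta>0 * exp (w t)) has_real_derivative 4 * lam\<^sup>2 * (\<beta>0 * exp (w t)) *
            (4 * (\<alpha>0 * exp (z t)) * (\<delta>0 * exp (z t)) - (M + N)\<^sup>2)) (at t within initial_interval T') \<and>
        ((\<lambda>t. \<gamma>0 * exp (w t)) has_real_derivative 4 * lam\<^sup>2 * (\<gamma>0 * exp (w t)) *
            (4 * (\<alpha>0 * exp (z t)) * (\<delta>0 * exp (z t)) - (M + N)\<^sup>2)) (at t within initial_interval T') \<and>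
        ((\<lambda>t. \<delta>0 * exp (z t)) has_real_derivative 4 * lam\<^sup>2 * (\<delta>0 * exp (z t)) *
            (4 * (\<beta>0 * exp (w t)) * (\<gamma>0 * exp (w t)) - (M - N)\<^sup>2)) (at t within initial_interval T')"
        by (intro conjI dz dw)
    qed
    from maximal[OF ext(1) this] ext(2) sol show False by auto
  qed
  \<comment> \<open>The limit of exp(y - x), that is, of
    (\<open>\<beta>\<close>/\<open>\<alpha>\<close>) /
    (\<open>\<beta>0\<close>/\<open>\<alpha>0\<close>).\<close>
  define s where "s = sqrt (4 * (\<alpha>0 * \<delta>0) / (4 * (\<beta>0 * \<gamma>0)))"
  define b where "b = \<beta>0 / \<alpha>0 * s"
  define c where "c = \<gamma>0 / \<alpha>0 * s"
  have s: "s > 0" "s\<^sup>2 = \<alpha>0 * \<delta>0 / (\<beta>0 * \<gamma>0)"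
    using pos by (simp_all add: s_def)
  have bc: "b > 0" "c > 0"
    unfolding b_def c_def by (intro mult_pos_pos pos s(1))+
  \<comment> \<open>The constant ratio \<open>\<delta>0 / \<alpha>0\<close> must equal
    \<open>b * c\<close> for the limit to have the shape treated in
    \<open>calJ_phi_0\<close>.\<close>
  have "b * c = \<beta>0 * \<gamma>0 / \<alpha>0\<^sup>2 * s\<^sup>2"
    by (simp add: b_def c_def power2_eq_square)
  also have "\<dots> = \<delta>0 / \<alpha>0"
  proof -
    have "\<beta>0 \<noteq> 0" "\<gamma>0 \<noteq> 0" using pos(5) by auto
    then show ?thesis unfolding s using pos(3) by (simp add: power2_eq_square)
  qed
  finally have d: "\<delta>0 / \<alpha>0 = b * c" ..
  have ev: "eventually (\<lambda>t. t \<in> ?I) (at_left r)"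
    by (rule eventually_initial_interval[OF r unbounded])
  have lim_s: "((\<lambda>t. exp (y t - x t)) \<longlongrightarrow> s) (at_left r)"
    unfolding s_def by (rule exp_diff_limit[OF r unbounded])
  have "((\<lambda>t. inverse \<alpha>0 * inverse (exp (x t))) \<longlongrightarrow> inverse \<alpha>0 * 0) (at_left r)"
    by (intro tendsto_intros tendsto_inverse_0_at_top filterlim_compose[OF exp_at_top]
        x_at_top[OF r unbounded])
  then have "((\<lambda>t. inverse (\<alpha> t)) \<longlongrightarrow> inverse \<alpha>0 * 0) (at_left r)"
    by (rule Lim_transform_eventually) (use ev in eventually_elim, simp add: sol)
  then have lim\<alpha>: "((\<lambda>t. inverse (\<alpha> t)) \<longlongrightarrow> 0) (at_left r)" by simp
  have lim\<beta>: "((\<lambda>t. \<beta> t / \<alpha> t) \<longlongrightarrow> b) (at_left r)"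
    unfolding b_def
    by (rule Lim_transform_eventually[OF tendsto_mult_left[OF lim_s]])
      (use ev in eventually_elim, simp add: sol exp_diff)
  have lim\<gamma>: "((\<lambda>t. \<gamma> t / \<alpha> t) \<longlongrightarrow> c) (at_left r)"
    unfolding c_def
    by (rule Lim_transform_eventually[OF tendsto_mult_left[OF lim_s]])
      (use ev in eventually_elim, simp add: sol exp_diff)
  have lim\<delta>: "((\<lambda>t. \<delta> t / \<alpha> t) \<longlongrightarrow> b * c) (at_left r)"
    unfolding d[symmetric]
    by (rule Lim_transform_eventually[OF tendsto_const])
      (use ev in eventually_elim, simp add: sol)
  have nz: "eventually (\<lambda>t. \<alpha> t \<noteq> 0) (at_left r)"
    using ev by eventually_elim (simp add: sol pos)
  show ?thesis
  proof (intro conjI exI[of _ "phi 0 0 1 b c (b * c)"] allI)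
    show "((\<lambda>t. inverse (\<alpha> t) * phi M N (\<alpha> t) (\<beta> t) (\<gamma> t) (\<delta> t) vs)
        \<longlongrightarrow> phi 0 0 1 b c (b * c) vs) (at_left (real_of_ereal T))" for vs
      using phi_scaled_limit[OF lim\<alpha> lim\<beta> lim\<gamma> lim\<delta> nz] by (simp add: r)
    show "calQ omega (phi 0 0 1 b c (b * c)) < 0"
      using bc lam_pos by (simp add: calQ_phi_0)
    show "harmonic_acs bracket omega (calJ omega (phi 0 0 1 b c (b * c)))"
      using bc by (simp add: calJ_phi_0 harmonic_acs_std_J)
  qed (rule T_finite)
qed

end
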